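(* Let $N\subset\mathbb{P}^2\times\mathbb{P}^5$ be the seven-dimensional manifold of non-incident pairs $(a,A)$, where $a\in\mathbb{P}^2=\mathbb{RP}^2$ is a point and $A\subset\mathbb{P}^2$ is an irreducible conic not containing $a$. Let $A$, $B$ be $3$ by $3$ matrices representing non-singular conics in $\mathbb{RP}^2$, and let $a$, $b$ be vectors in $\mathbb{R}^3\setminus\{0\}$ representing points in $\mathbb{RP}^2$. Two pairs $(a,A)$ and $(b,B)$ are dancing if and only if $$(a^{T}Aa)(b^{T}Bb)-(a^{T}Ba)(b^{T}Ab)=0.$$ The infinitesimal dancing condition gives rise to a conformal structure on $TN$ of signature $(++--000)$ which is degenerate along the fibres of a projection $N\to(\mathbb{P}^2\times(\mathbb{P}^2)^* )\setminus\mathcal{I}$ sending the conic $A$ to the polar line of $(a,A)$.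
   Context: A conic in $\mathbb{RP}^2$ is represented by a symmetric $3\times 3$ real matrix $A$ up to scale (a point of $\mathbb{P}^5$), and consists of the points $z$ with $z^TAz=0$. Dancing: two pairs $(a,A)$ and $(b,B)$ in $N$ are dancing if there exists an irreducible conic containing $a$, $b$ and the four points $A\cap B$ of intersection between $A$ and $B$. Infinitesimal dancing condition: set $b=a+\epsilon\dot a$, $B=A+\epsilon\dot A$ with $\epsilon$ small in the displayed equation and keep the second order in $\epsilon$; this gives a quadratic condition on $(\dot a,\dot A)\in T_{(a,A)}N$, and hence a (degenerate) conformal structure. $\mathcal{I}\subset\mathbb{P}^2\times(\mathbb{P}^2)^*$ is the set of incident pairs (point, line). The projection is $(a,A)\mapsto(a,\alpha)$, where $\alpha=\{z: a^TAz=0\}$ is the polar line of $a$ with respect to $A$.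
   Formalization: The equivalence is proved for distinct conics A, B when no reducible conic contains a, b and the four points of A∩B (it fails otherwise); for all distinct A, B, vanishing of the expression is shown equivalent to existence of a possibly reducible such conic. *)

theory Defs
  imports "HOL-Analysis.Analysis"
begin

section \<open>Conics\<close>

text \<open>
  Points of the real projective plane and conics are given by representatives: nonzero vectors
  \<open>a\<close> in \<open>real^3\<close> and nonzero symmetric matrices \<open>A\<close>; \<open>a \<bullet> (A *v a)\<close> is \<open>a\<^sup>T A a\<close>.
  The associated points of projective space are the lines \<open>span {a}\<close> and \<open>span {A}\<close>.
\<close>

definition conic :: "real^3^3 \<Rightarrow> bool" where
  "conic A \<longleftrightarrow> transpose A = A \<and> A \<noteq> 0"

definition cform :: "real^3^3 \<Rightarrow> complex^3 \<Rightarrow> complex" where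
  "cform A z = (\<Sum>i\<in>UNIV. \<Sum>j\<in>UNIV. complex_of_real (A $ i $ j) * z $ i * z $ j)"

text \<open>Irreducibility is meant over the complex numbers: a pair of complex conjugate lines is
  reducible, so that irreducible means the same as non-singular.\<close>

definition irreducible_conic :: "real^3^3 \<Rightarrow> bool" where
  "irreducible_conic A \<longleftrightarrow> conic A \<and>
     \<not> (\<exists>l m :: complex^3. \<forall>z. cform A z = (\<Sum>i\<in>UNIV. l $ i * z $ i) * (\<Sum>i\<in>UNIV. m $ i * z $ i))"

inductive cpolynomial :: "(complex^3 \<Rightarrow> complex) \<Rightarrow> bool" where
  const: "cpolynomial (\<lambda>z. c)"
| coord: "cpolynomial (\<lambda>z. z $ i)"
| add: "cpolynomial f \<Longrightarrow> cpolynomial g \<Longrightarrow> cpolynomial (\<lambda>z. f z + g z)"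
| mult: "cpolynomial f \<Longrightarrow> cpolynomial g \<Longrightarrow> cpolynomial (\<lambda>z. f z * g z)"

text \<open>
  Two distinct irreducible conics meet in four points only if complex points and multiplicities
  are taken into account. Accordingly \<open>C\<close> is said to contain \<open>A \<inter> B\<close> if it contains the
  intersection scheme: at every complex common point \<open>p\<close>, the equation of \<open>C\<close> lies in the
  ideal generated by the equations of \<open>A\<close> and \<open>B\<close> in the local ring at \<open>p\<close>, the denominator
  \<open>h\<close> being a unit there. At a transversal intersection point this just says that \<open>C\<close> passes
  through \<open>p\<close>; at a tangency it also prescribes the contact.
\<close>

definition contains_intersection :: "real^3^3 \<Rightarrow> real^3^3 \<Rightarrow> real^3^3 \<Rightarrow> bool" where
  "contains_intersection C A B \<longleftrightarrow>
     (\<forall>p. p \<noteq> 0 \<and> cform A p = 0 \<and> cform B p = 0 \<longrightarrow>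
        (\<exists>f g h. cpolynomial f \<and> cpolynomial g \<and> cpolynomial h \<and> h p \<noteq> 0 \<and>
           (\<forall>z. h z * cform C z = f z * cform A z + g z * cform B z)))"

lemma contains_intersection_point:
  assumes "contains_intersection C A B" "p \<noteq> 0" "cform A p = 0" "cform B p = 0"
  shows "cform C p = 0"
proof -
  obtain f g h where "h p \<noteq> 0" "\<forall>z. h z * cform C z = f z * cform A z + g z * cform B z"
    using assms unfolding contains_intersection_def by blast
  then have "h p * cform C p = 0"
    using assms(3,4) by simp
  with \<open>h p \<noteq> 0\<close> show ?thesis by simp
qed


section \<open>The manifold N and the projection\<close>

type_synonym rep = "(real^3) \<times> (real^3^3)"

text \<open>\<open>[(a, A)]\<close> as a point of the product of the projective plane and projective 5-space.\<close>

definition proj_class :: "rep \<Rightarrow> (real^3) set \<times> (real^3^3) set" where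
  "proj_class p = (span {fst p}, span {snd p})"

definition N :: "((real^3) set \<times> (real^3^3) set) set" where
  "N = {proj_class (a, A) | a A. a \<noteq> 0 \<and> irreducible_conic A \<and> a \<bullet> (A *v a) \<noteq> 0}"

definition proj_points :: "(real^3) set set" where
  "proj_points = {L. subspace L \<and> dim L = 1}"

definition proj_lines :: "(real^3) set set" where
  "proj_lines = {M. subspace M \<and> dim M = 2}"

definition incident_pairs :: "((real^3) set \<times> (real^3) set) set" where
  "incident_pairs = {(L, M) \<in> proj_points \<times> proj_lines. L \<subseteq> M}"

fun polar_projection :: "(real^3) set \<times> (real^3^3) set \<Rightarrow> (real^3) set \<times> (real^3) set" where
  "polar_projection (L, K) = (L, {z. \<forall>a\<in>L. \<forall>A\<in>K. a \<bullet> (A *v z) = 0})"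

lemma polar_projection_proj_class:
  "polar_projection (proj_class (a, A)) = (span {a}, {z. a \<bullet> (A *v z) = 0})"
proof -
  have "(\<forall>x\<in>span {a}. \<forall>X\<in>span {A}. x \<bullet> (X *v z) = 0) \<longleftrightarrow> a \<bullet> (A *v z) = 0" for z
    by (auto simp: span_singleton scaleR_matrix_vector_assoc [symmetric] intro: bspec
        dest!: bspec [where x = "1 *\<^sub>R a"] bspec [where x = "1 *\<^sub>R A"])
  then show ?thesis
    by (simp add: proj_class_def)
qed

definition polar_fibre :: "rep \<Rightarrow> ((real^3) set \<times> (real^3^3) set) set" where
  "polar_fibre p = {q \<in> N. polar_projection q = polar_projection (proj_class p)}"


section \<open>The dancing condition\<close>

definition conic_through :: "real^3^3 \<Rightarrow> rep \<Rightarrow> rep \<Rightarrow> bool" where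
  "conic_through C p q \<longleftrightarrow> conic C \<and> fst p \<bullet> (C *v fst p) = 0 \<and> fst q \<bullet> (C *v fst q) = 0 \<and>
     contains_intersection C (snd p) (snd q)"

definition dancing :: "rep \<Rightarrow> rep \<Rightarrow> bool" where
  "dancing p q \<longleftrightarrow> (\<exists>C. irreducible_conic C \<and> conic_through C p q)"

fun dancing_expr :: "rep \<Rightarrow> rep \<Rightarrow> real" where
  "dancing_expr (a, A) (b, B) =
     (a \<bullet> (A *v a)) * (b \<bullet> (B *v b)) - (a \<bullet> (B *v a)) * (b \<bullet> (A *v b))"


subsection \<open>The exceptional configurations\<close>

text \<open>
  The dancing expression also vanishes if \<open>A = B\<close> as conics, or if the conic through \<open>a\<close>, \<open>b\<close>
  and \<open>A \<inter> B\<close> is a pair of lines; in these cases the pairs need not be dancing. In the example below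
  that conic is \<open>x\<^sup>2 = z\<^sup>2\<close>, the four base points being \<open>(\<plusminus>1, \<plusminus>1, 1)\<close>.
\<close>

definition diag3 :: "real \<Rightarrow> real \<Rightarrow> real \<Rightarrow> real^3^3" where
  "diag3 x y z = vector [vector [x, 0, 0], vector [0, y, 0], vector [0, 0, z]]"

lemma cform_diag3: "cform (diag3 x y z) v = of_real x * v$1 * v$1 + of_real y * v$2 * v$2 + of_real z * v$3 * v$3"
  by (simp add: cform_def diag3_def sum_3)

lemma irreducible_diag3:
  assumes "x * y * z \<noteq> 0"
  shows "irreducible_conic (diag3 x y z)"
proof -
  have "transpose (diag3 x y z) = diag3 x y z"
    by (simp add: diag3_def vec_eq_iff forall_3 transpose_def)
  moreover have "diag3 x y z \<noteq> 0"
    using assms by (auto simp: diag3_def vec_eq_iff forall_3)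
  moreover have False if H: "\<forall>v. cform (diag3 x y z) v = (\<Sum>i\<in>UNIV. l $ i * v $ i) * (\<Sum>i\<in>UNIV. m $ i * v $ i)"
    for l m :: "complex^3"
  proof -
    have H': "of_real x * p * p + of_real y * q * q + of_real z * r * r =
      (l$1 * p + l$2 * q + l$3 * r) * (m$1 * p + m$2 * q + m$3 * r)" for p q r
      using H[rule_format, of "vector [p,q,r]"] by (simp add: cform_diag3 sum_3)
    have 1: "of_real x = l$1 * m$1" using H'[of 1 0 0] by simp
    have 2: "of_real y = l$2 * m$2" using H'[of 0 1 0] by simp
    have 3: "of_real z = l$3 * m$3" using H'[of 0 0 1] by simp
    have 4: "l$1 * m$2 = - (l$2 * m$1)" using H'[of 1 1 0] 1 2 by (simp add: algebra_simps eq_neg_iff_add_eq_0)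
    have 5: "l$2 * m$3 = - (l$3 * m$2)" using H'[of 0 1 1] 3 2 by (simp add: algebra_simps eq_neg_iff_add_eq_0)
    have 6: "l$3 * m$1 = - (l$1 * m$3)" using H'[of 1 0 1] 1 3 by (simp add: algebra_simps eq_neg_iff_add_eq_0)
    have "(l$1 * m$2) * (l$2 * m$3) * (l$3 * m$1) = - ((l$2 * m$1) * (l$3 * m$2) * (l$1 * m$3))"
      unfolding 4 5 6 by simp
    then have "complex_of_real x * of_real y * of_real z = - (of_real x * of_real y * of_real z)"
      unfolding 1 2 3 by (simp add: algebra_simps)
    then have "complex_of_real (x * y * z) = 0"
      by simp
    with assms show False by (simp del: of_real_mult)
  qed
  ultimately show ?thesis
    unfolding irreducible_conic_def conic_def by blast
qed

lemma dancing_converse_fails: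
  "\<exists>a A b B. proj_class (a, A) \<in> N \<and> proj_class (b, B) \<in> N \<and> span {A} \<noteq> span {B} \<and>
     dancing_expr (a, A) (b, B) = 0 \<and> \<not> dancing (a, A) (b, B)"
proof -
  define A where "A = diag3 1 1 (-2)"
  define B where "B = diag3 1 2 (-3)"
  define a :: "real^3" where "a = vector [1, 0, 1]"
  define b :: "real^3" where "b = vector [1, 2, 1]"
  note defs = A_def B_def a_def b_def diag3_def
  have i: "irreducible_conic A" "irreducible_conic B"
    unfolding A_def B_def by (simp_all add: irreducible_diag3)
  have v: "a \<bullet> (A *v a) = -1" "b \<bullet> (B *v b) = 6" "a \<bullet> (B *v a) = -2" "b \<bullet> (A *v b) = 3"
    by (simp_all add: defs inner_vec_def matrix_vector_mult_def sum_3)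
  have nz: "a \<noteq> 0" "b \<noteq> 0" by (auto simp: defs vec_eq_iff forall_3)
  have N: "proj_class (a, A) \<in> N" "proj_class (b, B) \<in> N"
    using i v nz unfolding N_def by force+
  have "B \<noteq> k *\<^sub>R A" for k
    by (auto simp: defs vec_eq_iff forall_3)
  then have sp: "span {A} \<noteq> span {B}"
    by (metis (no_types, lifting) insertI1 rangeE span_base span_singleton)
  have nd: "\<not> dancing (a, A) (b, B)"
  proof
    assume "dancing (a, A) (b, B)"
    then obtain C where C: "irreducible_conic C" "contains_intersection C A B"
      "a \<bullet> (C *v a) = 0" "b \<bullet> (C *v b) = 0"
      unfolding dancing_def conic_through_def by auto
    have "transpose C = C" using C by (simp add: irreducible_conic_def conic_def)
    then have sy: "C $ i $ j = C $ j $ i" for i j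
    proof -
      have "transpose C $ j $ i = C $ i $ j" by (simp add: transpose_def)
      with \<open>transpose C = C\<close> show ?thesis by simp
    qed
    have cC: "cform C (vector [s, t, 1]) = 0" if "s * s = 1" "t * t = 1" for s t
    proof (rule contains_intersection_point[OF C(2)])
      show "vector [s, t, 1] \<noteq> (0::complex^3)" by (auto simp: vec_eq_iff forall_3)
    qed (use that in \<open>simp_all add: A_def B_def cform_diag3 mult.assoc\<close>)
    have e: "complex_of_real (C$1$1 + C$2$2 + C$3$3) + s * t * of_real (2 * C$1$2) + s * of_real (2 * C$1$3) + t * of_real (2 * C$2$3) = 0"
      if "s * s = 1" "t * t = 1" for s t
    proof -
      have "of_real (C$1$1) * (s * s) + complex_of_real (C$2$2)*(t * t) + complex_of_real (C$3$3) + s * t * of_real (2 * C$1$2) + s * of_real (2 * C$1$3) + t * of_real (2 * C$2$3) = 0"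
      using cC[OF that] unfolding cform_def sum_3 sy[of 2 1] sy[of 3 1] sy[of 3 2] by (simp add: algebra_simps)
      then show ?thesis using that by simp
    qed
    have r: "C$1$1 + C$2$2 + C$3$3 + s * t * (2 * C$1$2) + s * (2 * C$1$3) + t * (2 * C$2$3) = 0"
      if "s * s = 1" "t * t = 1" for s t :: real
      using e[of "of_real s" "of_real t"] that
      unfolding of_real_mult[symmetric] of_real_add[symmetric] of_real_eq_0_iff by simp
    have "C$1$2 = 0 \<and> C$1$3 = 0 \<and> C$2$3 = 0 \<and> C$1$1 + C$2$2 + C$3$3 = 0"
      using r[of 1 1] r[of "-1" 1] r[of 1 "-1"] r[of "-1" "-1"] by simp
    moreover have "C$1$1 + C$3$3 + 2 * C$1$3 = 0"
      using C(3) sy[of 3 1] by (simp add: a_def inner_vec_def matrix_vector_mult_def sum_3)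
    ultimately have z: "C$1$2 = 0" "C$1$3 = 0" "C$2$3 = 0" "C$2$2 = 0" "C$3$3 = - C$1$1"
      by linarith+
    have "cform C v = (\<Sum>i\<in>UNIV. (vector [of_real (C$1$1), 0, of_real (C$1$1)] :: complex^3) $ i * v $ i) *
       (\<Sum>i\<in>UNIV. (vector [1, 0, -1] :: complex^3) $ i * v $ i)" for v
      unfolding cform_def sum_3 sy[of 2 1] sy[of 3 1] sy[of 3 2] z by (simp add: algebra_simps)
    then show False using C(1) unfolding irreducible_conic_def by blast
  qed
  show ?thesis
    using N sp nd v by (intro exI[of _ a] exI[of _ A] exI[of _ b] exI[of _ B]) simp
qed


section \<open>The infinitesimal dancing condition\<close>

text \<open>
  The coefficient of the second power of \<open>\<epsilon>\<close> in the dancing expression of \<open>p\<close> and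
  \<open>p + \<epsilon> v\<close>.
\<close>

definition dancing_form :: "rep \<Rightarrow> rep \<Rightarrow> real" where
  "dancing_form p v = (deriv ^^ 2) (\<lambda>\<epsilon>. dancing_expr p (p + \<epsilon> *\<^sub>R v)) 0 / 2"

text \<open>
  Tangent vectors of a set \<open>M\<close> in the product of projective spaces are handled through
  representatives. \<open>tangent_lifts M p\<close> consists of the velocities at \<open>p\<close> of curves of
  representatives of points of \<open>M\<close>. The tangent space of \<open>M\<close> at \<open>[p]\<close> is the quotient of
  \<open>tangent_lifts M p\<close> by \<open>rescalings p\<close>, the velocities of the curves which only change the
  representatives of \<open>a\<close> and \<open>A\<close>.
\<close>

definition tangent_lifts :: "((real^3) set \<times> (real^3^3) set) set \<Rightarrow> rep \<Rightarrow> rep set" where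
  "tangent_lifts M p = {v. \<exists>\<gamma> :: real \<Rightarrow> rep. \<gamma> 0 = p \<and> (\<gamma> has_vector_derivative v) (at 0) \<and>
     (\<forall>\<^sub>F t in nhds 0. proj_class (\<gamma> t) \<in> M)}"

definition rescalings :: "rep \<Rightarrow> rep set" where
  "rescalings p = span {(fst p, 0), (0, snd p)}"

definition polarization :: "('v::real_vector \<Rightarrow> real) \<Rightarrow> 'v \<Rightarrow> 'v \<Rightarrow> real" where
  "polarization Q u v = (Q (u + v) - Q u - Q v) / 2"

definition quadratic_form :: "('v::real_vector \<Rightarrow> real) \<Rightarrow> bool" where
  "quadratic_form Q \<longleftrightarrow> bilinear (polarization Q) \<and> (\<forall>v. Q v = polarization Q v v)"

definition radical_on :: "'v::real_vector set \<Rightarrow> ('v \<Rightarrow> real) \<Rightarrow> 'v set" where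
  "radical_on W Q = {u \<in> W. \<forall>w\<in>W. polarization Q u w = 0}"

text \<open>
  \<open>Q\<close> restricted to \<open>W\<close> descends to the quotient of \<open>W\<close> by \<open>K\<close>, and the quotient has an
  orthogonal basis, represented by \<open>P \<union> M \<union> Z\<close>, with \<open>p\<close> vectors of square 1, \<open>m\<close> vectors of
  square -1 and \<open>z\<close> vectors of square 0.
\<close>

definition quotient_signature ::
  "'v::real_vector set \<Rightarrow> 'v set \<Rightarrow> ('v \<Rightarrow> real) \<Rightarrow> nat \<Rightarrow> nat \<Rightarrow> nat \<Rightarrow> bool" where
  "quotient_signature W K Q p m z \<longleftrightarrow>
     subspace W \<and> subspace K \<and> K \<subseteq> radical_on W Q \<and> quadratic_form Q \<and>
     (\<exists>P M Z. finite P \<and> finite M \<and> finite Z \<and> card P = p \<and> card M = m \<and> card Z = z \<and>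
        P \<inter> M = {} \<and> P \<inter> Z = {} \<and> M \<inter> Z = {} \<and>
        independent (P \<union> M \<union> Z) \<and> span (P \<union> M \<union> Z) \<inter> K = {0} \<and> span (P \<union> M \<union> Z \<union> K) = W \<and>
        (\<forall>u\<in>P \<union> M \<union> Z. \<forall>v\<in>P \<union> M \<union> Z. u \<noteq> v \<longrightarrow> polarization Q u v = 0) \<and>
        (\<forall>u\<in>P. Q u = 1) \<and> (\<forall>u\<in>M. Q u = -1) \<and> (\<forall>u\<in>Z. Q u = 0))"

end

theory Submission
  imports Defs
    "HOL-Computational_Algebra.Polynomial_Factorial"
    "HOL-Computational_Algebra.Field_as_Ring"
    "HOL-Computational_Algebra.Fundamental_Theorem_Algebra"
begin

text \<open>
  Parametrize the complex conic \<open>A\<close> by quadratic polynomials. The equations of \<open>B\<close> and \<open>C\<close>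
  pull back to polynomials of degree at most 4, and containment of the intersection scheme in \<open>C\<close>
  makes the first divide the second; the first has degree 4, so the quotient is a constant \<open>m\<close>.
  Hence \<open>C - m B\<close> vanishes on \<open>A\<close>, so that \<open>C\<close> lies in the pencil of \<open>A\<close> and \<open>B\<close>.
  A member \<open>l A + m B\<close> of the pencil passes through \<open>a\<close> and \<open>b\<close> iff \<open>(l, m)\<close> solves
  a homogeneous \<open>2 \<times> 2\<close> system whose determinant is the dancing expression.

  With \<open>\<xi>(V) = (a\<^sup>T A a) V a - (a\<^sup>T V a) A a\<close>, a vector orthogonal to \<open>a\<close>, the dancing form is
  \<open>2 \<xi>(V)\<^sup>T u\<close> on the tangent vector \<open>(u, V)\<close>. It is the hyperbolic pairing of \<open>\<xi>(V)\<close> with the class of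
  \<open>u\<close> modulo \<open>a\<close>, which has signature \<open>(2, 2)\<close>. Its radical is given by \<open>u \<in> \<real> a\<close> and
  \<open>V a \<in> \<real> A a\<close>, the condition that \<open>a\<close> and its polar line remain fixed to first order.
\<close>

subsection \<open>The bilinear form of a matrix\<close>

definition qf :: "real^3^3 \<Rightarrow> real^3 \<Rightarrow> real^3 \<Rightarrow> real" where
  "qf A x y = x \<bullet> (A *v y)"

lemma qf_sum: "qf A x y = (\<Sum>i\<in>UNIV. \<Sum>j\<in>UNIV. A $ i $ j * x $ i * y $ j)"
  by (simp add: qf_def inner_vec_def matrix_vector_mult_def sum_distrib_left mult_ac)

lemma qf_add: "qf A (x + y) z = qf A x z + qf A y z" "qf A z (x + y) = qf A z x + qf A z y"
    "qf (A + B) x y = qf A x y + qf B x y"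
  and qf_diff: "qf A (x - y) z = qf A x z - qf A y z" "qf A z (x - y) = qf A z x - qf A z y"
    "qf (A - B) x y = qf A x y - qf B x y"
  and qf_scaleR: "qf A (c *\<^sub>R x) z = c * qf A x z" "qf A z (c *\<^sub>R x) = c * qf A z x"
    "qf (c *\<^sub>R A) x y = c * qf A x y"
  by (simp_all add: qf_sum sum_3 algebra_simps)

lemma qf_zero [simp]: "qf A 0 y = 0" "qf A x 0 = 0" "qf 0 x y = 0"
  by (simp_all add: qf_sum)

lemma transpose_eq_iff: "transpose A = A \<longleftrightarrow> (\<forall>i j. A $ i $ j = A $ j $ i)"
  by (auto simp: vec_eq_iff transpose_def)

lemma qf_sym:
  assumes "transpose A = A"
  shows "qf A x y = qf A y x"
  by (metis assms dot_lmul_matrix inner_commute qf_def vector_transpose_matrix)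

text \<open>Polarization recovers a symmetric bilinear form from its diagonal values, and standard
  basis vectors then read off the entries.\<close>

lemma sym_eq_0_if_qf_0:
  assumes "transpose A = A" "\<And>x. qf A x x = 0"
  shows "A = 0"
proof -
  have "qf A x y = 0" for x y
    using assms(2)[of "x + y"] assms(2)[of x] assms(2)[of y] qf_sym[OF assms(1), of x y]
    by (simp add: qf_add)
  from this[of "axis _ 1" "axis _ 1"] show ?thesis
    by (simp add: vec_eq_iff qf_def matrix_vector_mult_basis inner_axis' column_def)
qed

subsection \<open>Non-singular conics over the complex numbers\<close>

text \<open>Bilinear, not sesquilinear: there is no conjugation, so that \<open>cbf M z z\<close> is
  a polynomial in \<open>z\<close>.\<close>

definition cbf :: "complex^3^3 \<Rightarrow> complex^3 \<Rightarrow> complex^3 \<Rightarrow> complex" where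
  "cbf M y z = (\<Sum>i\<in>UNIV. \<Sum>j\<in>UNIV. M $ i $ j * y $ i * z $ j)"

definition cmat :: "real^3^3 \<Rightarrow> complex^3^3" where
  "cmat A = (\<chi> i j. of_real (A $ i $ j))"

lemma cform_eq_cbf: "cform A z = cbf (cmat A) z z"
  by (simp add: cform_def cbf_def cmat_def)

lemma cform_of_real: "cform A (\<chi> i. of_real (x $ i)) = of_real (qf A x x)"
  by (simp add: cform_def qf_sum)

lemma cbf_add: "cbf M (x + y) z = cbf M x z + cbf M y z" "cbf M z (x + y) = cbf M z x + cbf M z y"
  and cbf_diff: "cbf M (x - y) z = cbf M x z - cbf M y z" "cbf M z (x - y) = cbf M z x - cbf M z y"
    "cbf (M - M') x y = cbf M x y - cbf M' x y"
  and cbf_scale: "cbf M (c *s x) z = c * cbf M x z" "cbf M z (c *s x) = c * cbf M z x"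

  by (simp_all add: cbf_def sum_3 algebra_simps vector_scalar_mult_def)

lemma cbf_zero [simp]: "cbf M 0 y = 0" "cbf M x 0 = 0"
  by (simp_all add: cbf_def)

lemma cbf_sym: "transpose M = M \<Longrightarrow> cbf M x y = cbf M y x"
  unfolding cbf_def transpose_eq_iff by (subst sum.swap) (simp add: mult_ac)

text \<open>The matrix of a product of two linear forms is half of \<open>l m^T + m l^T\<close>,
  which has rank at most 2. Its entries are found by evaluating at basis vectors and sums of two of
  them.\<close>

lemma det_0_if_product:
  assumes "transpose A = A"
    and H: "\<And>z. cform A z = (\<Sum>i\<in>UNIV. l $ i * z $ i) * (\<Sum>i\<in>UNIV. m $ i * z $ i)"
  shows "det A = 0"
proof -
  note s = assms(1)[unfolded transpose_eq_iff, rule_format]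
  have e: "complex_of_real (A $ 1 $ 1) * p * p + of_real (A $ 2 $ 2) * q * q + of_real (A $ 3 $ 3) * r * r
      + 2 * of_real (A $ 1 $ 2) * p * q + 2 * of_real (A $ 1 $ 3) * p * r + 2 * of_real (A $ 2 $ 3) * q * r
      = (l$1 * p + l$2 * q + l$3 * r) * (m$1 * p + m$2 * q + m$3 * r)" for p q r
    using H[of "vector [p,q,r]"] s[of 2 1] s[of 3 1] s[of 3 2]
    by (simp add: cform_def sum_3 algebra_simps)
  have d: "complex_of_real (A $ 1 $ 1) = l$1 * m$1" "complex_of_real (A $ 2 $ 2) = l$2 * m$2"
     "complex_of_real (A $ 3 $ 3) = l$3 * m$3"
    using e[of 1 0 0] e[of 0 1 0] e[of 0 0 1] by simp_all
  have o: "complex_of_real (A $ 1 $ 2) = (l$1 * m$2 + l$2 * m$1) / 2"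
     "complex_of_real (A $ 1 $ 3) = (l$1 * m$3 + l$3 * m$1) / 2"
     "complex_of_real (A $ 2 $ 3) = (l$2 * m$3 + l$3 * m$2) / 2"
    using e[of 1 1 0] e[of 1 0 1] e[of 0 1 1] d by (simp_all add: field_simps)
  have "complex_of_real (det A) = 0"
    unfolding det_3 s[of 2 1] s[of 3 1] s[of 3 2] of_real_add of_real_diff of_real_mult d o
    by (simp add: field_simps)
  then show ?thesis by simp
qed

text \<open>For \<open>a\<close> nonzero the two factors come from the roots of the quadratic, with
  \<open>s\<close> a square root of the quarter discriminant; for \<open>a = 0\<close> the factor
  \<open>y\<close> splits off.\<close>

lemma binary_form_factors:
  fixes a b c :: complex
  obtains l1 l2 m1 m2 where "\<And>x y. a * x * x + 2 * b * x * y + c * y * y = (l1 * x + l2 * y) * (m1 * x + m2 * y)"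
proof (cases "a = 0")
  case True
  show ?thesis
    by (rule that[of 0 1 "2 * b" c]) (simp add: True algebra_simps)
next
  case False
  define s where "s = csqrt (b^2 - a * c)"
  have s: "s * s = b * b - a * c"
    unfolding s_def by (metis power2_csqrt power2_eq_square)
  have c: "c = (b * b - s * s) / a" using False by (simp add: s)
  show ?thesis
    apply (rule that[of a "b + s" 1 "(b - s) / a"])
    using False by (simp add: c field_simps)
qed

text \<open>The form depends only on the class of \<open>z\<close> modulo the kernel vector, so it
  is a binary form in two coordinates, and such a form factors over the complex numbers.\<close>

lemma product_if_kernel:
  assumes sy: "transpose A = A" and k: "A *v k = 0" "k \<noteq> 0"
  shows "\<exists>l m. \<forall>z. cform A z = (\<Sum>i\<in>UNIV. l $ i * z $ i) * (\<Sum>i\<in>UNIV. m $ i * z $ i)"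
proof -
  define K :: "complex^3" where "K = (\<chi> i. of_real (k $ i))"
  obtain n where n: "k $ n \<noteq> 0" using k by (auto simp: vec_eq_iff)
  then have Kn: "K $ n \<noteq> 0" by (simp add: K_def)
  obtain i j where U: "UNIV = {n, i, j}" and d: "n \<noteq> i" "n \<noteq> j" "i \<noteq> j"
  proof -
    have "n = 1 \<or> n = 2 \<or> n = 3" by (rule exhaust_3)
    then show ?thesis
      using that[of 1 2] that[of 2 3] that[of 1 3] unfolding UNIV_3 by (elim disjE) auto
  qed
  have ct: "transpose (cmat A) = cmat A"
    using sy by (simp add: transpose_eq_iff cmat_def)
  have K0: "cbf (cmat A) x K = 0" for x
  proof -
    have "(\<Sum>j\<in>UNIV. A $ i $ j * k $ j) = 0" for i
      using k(1) by (simp add: vec_eq_iff matrix_vector_mult_def)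
    then have "(\<Sum>j\<in>UNIV. complex_of_real (A $ i $ j) * K $ j) = 0" for i
      unfolding K_def by (simp flip: of_real_mult of_real_sum)
    then show ?thesis
      by (simp add: cbf_def cmat_def mult.assoc mult.left_commute[of _ "x $ _"] flip: sum_distrib_left)
  qed
  then have K0': "cbf (cmat A) K x = 0" for x using cbf_sym[OF ct] by metis
  obtain l1 l2 m1 m2 where f: "\<And>x y. complex_of_real (A $ i $ i) * x * x + 2 * of_real (A $ i $ j) * x * y
      + of_real (A $ j $ j) * y * y = (l1 * x + l2 * y) * (m1 * x + m2 * y)"
    by (rule binary_form_factors[of "of_real (A $ i $ i)" "of_real (A $ i $ j)" "of_real (A $ j $ j)"], rule that)
  \<comment> \<open>The coefficient at \<open>n\<close> is chosen so that the linear form vanishes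
    on \<open>K\<close>; it therefore takes the same value on \<open>z\<close> and on the
    representative \<open>y\<close> with \<open>y $ n = 0\<close>.\<close>
  define L :: "complex \<Rightarrow> complex \<Rightarrow> complex^3" where
    "L p q = (\<chi> r. if r = i then p else if r = j then q else - (p * K $ i + q * K $ j) / K $ n)" for p q
  have "cform A z = (\<Sum>r\<in>UNIV. L l1 l2 $ r * z $ r) * (\<Sum>r\<in>UNIV. L m1 m2 $ r * z $ r)" for z
  proof -
    define c where "c = z $ n / K $ n"
    define y where "y = z - c *s K"
    have y: "y $ n = 0" "y $ i = z $ i - c * K $ i" "y $ j = z $ j - c * K $ j"
      using Kn by (simp_all add: y_def c_def)
    have L: "(\<Sum>r\<in>UNIV. L p q $ r * z $ r) = p * y $ i + q * y $ j" for p q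
    proof -
      have "(\<Sum>r\<in>UNIV. L p q $ r * z $ r) = - (p * K $ i + q * K $ j) / K $ n * z $ n + (p * z $ i + q * z $ j)"
        unfolding U using d by (simp add: L_def)
      also have "\<dots> = p * y $ i + q * y $ j"
        unfolding y c_def using Kn by (simp add: field_simps)
      finally show ?thesis .
    qed
    have "cform A z = cbf (cmat A) y y"
      unfolding y_def by (simp add: cform_eq_cbf cbf_diff cbf_scale K0 K0')
    also have "\<dots> = of_real (A $ i $ i) * y $ i * y $ i + 2 * of_real (A $ i $ j) * y $ i * y $ j
      + of_real (A $ j $ j) * y $ j * y $ j"
    proof -
      have "A $ j $ i = A $ i $ j" using sy by (simp add: transpose_eq_iff)
      then show ?thesis
        using d unfolding cbf_def U by (simp add: y(1) cmat_def)
    qed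
    finally show ?thesis unfolding f L .
  qed
  then show ?thesis by blast
qed

lemma det_nonzero_iff_kernel:
  fixes A :: "'a::field^'n^'n"
  shows "det A \<noteq> 0 \<longleftrightarrow> (\<forall>x. A *v x = 0 \<longrightarrow> x = 0)"
  unfolding invertible_det_nz[symmetric] invertible_left_inverse matrix_left_invertible_ker ..

text \<open>In this form irreducibility is seen to be an open condition on symmetric matrices,
  stable under nonzero scaling.\<close>

lemma irreducible_conic_iff_det: "irreducible_conic A \<longleftrightarrow> transpose A = A \<and> det A \<noteq> 0"
proof
  assume A: "irreducible_conic A"
  then have sy: "transpose A = A" by (simp add: irreducible_conic_def conic_def)
  have "det A \<noteq> 0"
  proof
    assume "det A = 0"
    then obtain k where "A *v k = 0" "k \<noteq> 0"
      using det_nonzero_iff_kernel by blast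
    from product_if_kernel[OF sy this] A show False
      unfolding irreducible_conic_def by blast
  qed
  with sy show "transpose A = A \<and> det A \<noteq> 0" ..
next
  assume "transpose A = A \<and> det A \<noteq> 0"
  moreover from this have "A \<noteq> 0" by (auto simp: det_3)
  ultimately show "irreducible_conic A"
    unfolding irreducible_conic_def conic_def using det_0_if_product by blast
qed

subsection \<open>Parametrization of a conic\<close>

lemma cbf_eq_dot: "cbf M z x = z $ 1 * (M *v x) $ 1 + z $ 2 * (M *v x) $ 2 + z $ 3 * (M *v x) $ 3"
  by (simp add: cbf_def sum_3 matrix_vector_mult_def algebra_simps)

text \<open>The isotropic vector \<open>p\<close> is completed to a hyperbolic pair
  \<open>p\<close>, \<open>u\<close>; the orthogonal complement of that plane is a line, spanned by
  the unit vector \<open>w\<close>.\<close>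

lemma conic_basis:
  fixes M :: "complex^3^3"
  assumes sy: "transpose M = M" and nd: "\<And>z. (\<And>y. cbf M y z = 0) \<Longrightarrow> z = 0"
    and p: "p \<noteq> 0" "cbf M p p = 0"
  obtains u w where "cbf M u u = 0" "cbf M p u = 1" "cbf M p w = 0" "cbf M u w = 0" "cbf M w w = 1"
    "\<And>z. z = cbf M z u *s p + cbf M z p *s u + cbf M z w *s w"
proof -
  note cs = cbf_sym[OF sy]
  obtain u0 where u0: "cbf M u0 p \<noteq> 0" using nd p by blast
  define u1 where "u1 = (1 / cbf M u0 p) *s u0"
  have u1: "cbf M u1 p = 1" "cbf M p u1 = 1" using u0 by (simp_all add: u1_def cbf_scale cs[of p u0])
  \<comment> \<open>Since \<open>p\<close> is isotropic, subtracting a multiple of it leaves the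
    pairing with \<open>p\<close> at 1; half the square of \<open>u1\<close> makes the result
    isotropic.\<close>
  define u where "u = u1 - (cbf M u1 u1 / 2) *s p"
  have u: "cbf M u u = 0" "cbf M p u = 1" "cbf M u p = 1"
    by (simp_all add: u_def cbf_diff cbf_scale p u1)
  define f where "f = M *v p"
  define g where "g = M *v u"
  note fg = f_def[symmetric] g_def[symmetric]
  \<comment> \<open>The cross product of \<open>M *v p\<close> and \<open>M *v u\<close>, hence
    orthogonal to \<open>p\<close> and \<open>u\<close> with respect to the form.\<close>
  define w0 :: "complex^3" where "w0 = vector [f$2 * g$3 - f$3 * g$2, f$3 * g$1 - f$1 * g$3, f$1 * g$2 - f$2 * g$1]"
  have w0_nz: "w0 \<noteq> 0"
  proof
    assume "w0 = 0"
    then have e: "f$2 * g$3 = f$3 * g$2" "f$3 * g$1 = f$1 * g$3" "f$1 * g$2 = f$2 * g$1"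
      by (simp_all add: w0_def vec_eq_iff forall_3)
    \<comment> \<open>If \<open>f\<close> and \<open>g\<close> were proportional, the Gram
      determinant of \<open>p\<close> and \<open>u\<close> would vanish, but it equals -1.\<close>
    have "(u$1 * f$1 + u$2 * f$2 + u$3 * f$3) * (p$1 * g$1 + p$2 * g$2 + p$3 * g$3)
      = (p$1 * f$1 + p$2 * f$2 + p$3 * f$3) * (u$1 * g$1 + u$2 * g$2 + u$3 * g$3)"
      using e by algebra
    then have "cbf M u p * cbf M p u = cbf M p p * cbf M u u"
      unfolding cbf_eq_dot fg .
    then show False using u p by simp
  qed
  then obtain n where n: "w0 $ n \<noteq> 0" by (auto simp: vec_eq_iff)
  have perp: "\<exists>k. z = k *s w0" if "cbf M z p = 0" "cbf M z u = 0" for z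
  proof -
    have "z$1 * f$1 + z$2 * f$2 + z$3 * f$3 = 0" "z$1 * g$1 + z$2 * g$2 + z$3 * g$3 = 0"
      using that unfolding cbf_eq_dot fg by simp_all
    then have "w0 $ 1 * z $ 2 = w0 $ 2 * z $ 1" "w0 $ 1 * z $ 3 = w0 $ 3 * z $ 1" "w0 $ 2 * z $ 3 = w0 $ 3 * z $ 2"
      unfolding w0_def vector_3 by algebra+
    then have "w0 $ n * z $ j = w0 $ j * z $ n" for j
      using exhaust_3[of n] exhaust_3[of j] by auto
    then have "z = (z $ n / w0 $ n) *s w0"
      using n by (simp add: vec_eq_iff field_simps)
    then show ?thesis by blast
  qed
  have w0: "cbf M w0 p = 0" "cbf M w0 u = 0"
    unfolding cbf_eq_dot fg by (simp_all add: w0_def algebra_simps)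
  then have w0': "cbf M p w0 = 0" "cbf M u w0 = 0" using cs by metis+
  have dec: "\<exists>k. z = cbf M z u *s p + cbf M z p *s u + k *s w0" for z
  proof -
    have "\<exists>k. z - cbf M z u *s p - cbf M z p *s u = k *s w0"
      by (rule perp) (simp_all add: cbf_diff cbf_scale p u)
    then obtain k where "z - cbf M z u *s p - cbf M z p *s u = k *s w0" ..
    then have "z = cbf M z u *s p + cbf M z p *s u + k *s w0"
      by (simp add: algebra_simps)
    then show ?thesis ..
  qed
  \<comment> \<open>If \<open>w0\<close> were isotropic, it would be orthogonal to all of
    \<open>p\<close>, \<open>u\<close>, \<open>w0\<close>, against nondegeneracy.\<close>
  have ww: "cbf M w0 w0 \<noteq> 0"
  proof
    assume a: "cbf M w0 w0 = 0"
    have "cbf M z w0 = 0" for z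
    proof -
      obtain k where "z = cbf M z u *s p + cbf M z p *s u + k *s w0" using dec by blast
      then have "cbf M z w0 = cbf M (cbf M z u *s p + cbf M z p *s u + k *s w0) w0" by simp
      also have "\<dots> = 0" by (simp add: cbf_add cbf_scale a w0')
      finally show ?thesis .
    qed
    with nd w0_nz show False by blast
  qed
  define r where "r = csqrt (cbf M w0 w0)"
  have r: "r * r = cbf M w0 w0" unfolding r_def by (metis power2_csqrt power2_eq_square)
  have rn: "r \<noteq> 0" using r ww by auto
  define w where "w = (1 / r) *s w0"
  have w: "cbf M p w = 0" "cbf M u w = 0" "cbf M w p = 0" "cbf M w u = 0" "cbf M w w = 1"
    using rn by (simp_all add: w_def cbf_scale w0 w0' r[symmetric])
  have w0w: "w0 = r *s w" using rn by (simp add: w_def)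
  have "z = cbf M z u *s p + cbf M z p *s u + cbf M z w *s w" for z
  proof -
    obtain k where k: "z = cbf M z u *s p + cbf M z p *s u + (k * r) *s w" 
      using dec[of z] by (auto simp: w0w)
    then have "cbf M z w = cbf M (cbf M z u *s p + cbf M z p *s u + (k * r) *s w) w" by simp
    also have "\<dots> = k * r" by (simp add: cbf_add cbf_scale w)
    finally show ?thesis using k by simp
  qed
  with that u w show ?thesis by blast
qed

text \<open>In coordinates \<open>\<beta>\<close>, \<open>\<gamma>\<close>, \<open>\<delta>\<close> along \<open>p\<close>, \<open>u\<close>, \<open>w\<close> the conic is \<open>2 \<beta> \<gamma> + \<delta>\<^sup>2 = 0\<close>.
  The point \<open>p\<close> is the parameter
  value infinity; it will be chosen outside \<open>B\<close>, so that affine parameters see all of \<open>A \<inter> B\<close>.\<close>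

definition conic_param :: "complex^3 \<Rightarrow> complex^3 \<Rightarrow> complex^3 \<Rightarrow> complex \<Rightarrow> complex^3" where
  "conic_param p u w x = (x * x) *s p - 2 *s u - (2 * x) *s w"

text \<open>The coefficients of the form \<open>D\<close> pulled back along
  \<open>conic_param\<close>. The leading one is the value of \<open>D\<close> at \<open>p\<close>,
  so the degree is exactly 4 when \<open>p\<close> lies off \<open>D\<close>.\<close>

definition param_poly :: "complex^3^3 \<Rightarrow> complex^3 \<Rightarrow> complex^3 \<Rightarrow> complex^3 \<Rightarrow> complex poly" where
  "param_poly D p u w = [: 4 * cbf D u u, 8 * cbf D u w, 4 * cbf D w w - 4 * cbf D p u,
      - 4 * cbf D p w, cbf D p p :]"

lemma poly_param_poly:
  assumes "transpose D = D"
  shows "poly (param_poly D p u w) x = cbf D (conic_param p u w x) (conic_param p u w x)"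
  using cbf_sym[OF assms, of w u] cbf_sym[OF assms, of w p] cbf_sym[OF assms, of u p]
  by (simp add: param_poly_def conic_param_def cbf_add cbf_diff cbf_scale algebra_simps)

text \<open>Five vanishing coefficients leave one free parameter among the six entries of
  \<open>D\<close> in the basis: \<open>D\<close> has the Gram matrix of \<open>M\<close> times
  \<open>cbf D p u\<close>.\<close>

lemma form_multiple_if_param_poly_0:
  assumes sM: "transpose M = M" and sD: "transpose D = D" 
    and b: "cbf M u u = 0" "cbf M p u = 1" "cbf M p p = 0" "cbf M p w = 0" "cbf M u w = 0" "cbf M w w = 1"
    "\<And>z. z = cbf M z u *s p + cbf M z p *s u + cbf M z w *s w"
    and D0: "param_poly D p u w = 0"
  shows "cbf D z z = cbf D p u * cbf M z z"
proof -
  have d: "cbf D u u = 0" "cbf D u w = 0" "cbf D w w = cbf D p u" "cbf D p w = 0" "cbf D p p = 0"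
    using D0 by (simp_all add: param_poly_def)
  obtain x y t where z: "z = x *s p + y *s u + t *s w" using b(7)[of z] by blast
  show ?thesis
    unfolding z using d b(1-6) cbf_sym[OF sD, of w u] cbf_sym[OF sD, of w p] cbf_sym[OF sD, of u p]
      cbf_sym[OF sM, of w u] cbf_sym[OF sM, of w p] cbf_sym[OF sM, of u p]
    by (simp add: cbf_add cbf_scale algebra_simps)
qed

section \<open>From the local rings at the intersection points to divisibility in one
  variable\<close>

lemma cpolynomial_param:
  assumes "cpolynomial f"
  shows "\<exists>q. \<forall>x. f (conic_param p u w x) = poly q x"
  using assms
proof induction
  case (const c)
  show ?case by (rule exI[of _ "[:c:]"]) simp
next
  case (coord i)
  show ?case by (rule exI[of _ "[: - 2 * u $ i, - 2 * w $ i, p $ i :]"]) (simp add: conic_param_def algebra_simps)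
next
  case (add f g)
  then obtain q r where "\<forall>x. f (conic_param p u w x) = poly q x" "\<forall>x. g (conic_param p u w x) = poly r x" by blast
  then show ?case by (intro exI[of _ "q + r"]) simp
next
  case (mult f g)
  then obtain q r where "\<forall>x. f (conic_param p u w x) = poly q x" "\<forall>x. g (conic_param p u w x) = poly r x" by blast
  then show ?case by (intro exI[of _ "q * r"]) simp
qed

text \<open>Divide both polynomials by their gcd. A nonconstant cofactor \<open>r\<close> of
  \<open>B\<close> would have a root, and the local relation \<open>h * s = g * r\<close> would make
  it a root of \<open>s\<close> too, against coprimality.\<close>

lemma poly_dvd_if_locally_dvd:
  fixes B C :: "complex poly"
  assumes "B \<noteq> 0" and loc: "\<And>x. poly B x = 0 \<Longrightarrow> \<exists>g h. poly h x \<noteq> 0 \<and> h * C = g * B"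
  shows "B dvd C"
proof -
  define d where "d = gcd B C"
  have "d \<noteq> 0" using assms(1) by (simp add: d_def)
  obtain r s where r: "B = d * r" and s: "C = d * s" 
    unfolding d_def by (meson dvdE gcd_dvd1 gcd_dvd2)
  have cop: "coprime r s"
    using gcd_coprime[of B C r s] r s \<open>d \<noteq> 0\<close> unfolding d_def by (simp add: mult.commute)
  have "degree r = 0"
  proof (rule ccontr)
    assume "degree r \<noteq> 0"
    then obtain x where x: "poly r x = 0"
      using fundamental_theorem_of_algebra[of r] by (auto simp: constant_degree)
    then have "poly B x = 0" by (simp add: r)
    then obtain g h where gh: "poly h x \<noteq> 0" "h * C = g * B" using loc by blast
    then have "d * (h * s) = d * (g * r)" by (simp add: r s mult_ac)
    then have "h * s = g * r" using \<open>d \<noteq> 0\<close> by simp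
    then have "poly h x * poly s x = 0" using x by (metis mult_zero_right poly_mult)
    then have "poly s x = 0" using gh by simp
    with x have "[:- x, 1:] dvd r" "[:- x, 1:] dvd s" by (simp_all add: poly_eq_0_iff_dvd)
    with cop have "is_unit [:- x, 1:]" by (meson coprime_common_divisor)
    then show False by (simp add: is_unit_iff_degree)
  qed
  moreover have "r \<noteq> 0" using r assms(1) by auto
  ultimately have "is_unit r" by (simp add: is_unit_iff_degree)
  then show ?thesis using r s by (metis dvd_triv_left mult_unit_dvd_iff)
qed

subsection \<open>The pencil spanned by two conics\<close>

lemma cmat_sym: "transpose A = A \<Longrightarrow> transpose (cmat A) = cmat A"
  by (simp add: transpose_eq_iff cmat_def)

lemma cbf_cmat_nondegenerate:
  assumes "irreducible_conic A" "\<And>y. cbf (cmat A) y z = 0"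
  shows "z = 0"
proof -
  have "det (cmat A) = of_real (det A)"
    by (simp add: det_3 cmat_def)
  then have "det (cmat A) \<noteq> 0"
    using assms(1) by (simp add: irreducible_conic_iff_det)
  moreover have "cmat A *v z = 0"
    using assms(2)[of "axis _ 1"]
    by (simp add: cbf_def vec_eq_iff matrix_vector_mult_def axis_def if_distrib if_distribR sum.If_cases mult_ac)
  ultimately show ?thesis
    using det_nonzero_iff_kernel by blast
qed

text \<open>The point is sought on the line where the third coordinate vanishes: either the first
  basis vector, or a root of a quadratic polynomial.\<close>

lemma conic_has_complex_point: "\<exists>p. p \<noteq> 0 \<and> cform A p = 0"
proof (cases "A $ 1 $ 1 = 0")
  case True
  then show ?thesis
    by (intro exI[of _ "axis 1 1"]) (simp add: cform_def sum_3 axis_eq_0_iff, simp add: axis_def)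
next
  case False
  define a b c where "a = complex_of_real (A $ 1 $ 1)" "b = complex_of_real (A $ 1 $ 2 + A $ 2 $ 1)"
    "c = complex_of_real (A $ 2 $ 2)"
  have "degree [:c, b, a:] \<noteq> 0" using False by (simp add: a_b_c_def)
  then obtain x where "poly [:c, b, a:] x = 0"
    using fundamental_theorem_of_algebra[of "[:c, b, a:]"] by (auto simp: constant_degree)
  then have "cform A (vector [x, 1, 0]) = 0"
    by (simp add: cform_def sum_3 a_b_c_def algebra_simps)
  moreover have "vector [x, 1, 0] \<noteq> (0 :: complex^3)"
    by (simp add: vec_eq_iff forall_3)
  ultimately show ?thesis by blast
qed

section \<open>Proportional representatives and complex linear relations between real conics\<close>

lemma span_scaleR_singleton:
  fixes x :: "'a::real_vector"
  assumes "k \<noteq> 0"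
  shows "span {k *\<^sub>R x} = span {x}"
proof -
  have "(1 / k) *\<^sub>R (k *\<^sub>R x) \<in> span {k *\<^sub>R x}"
    by (intro span_mul span_base) simp
  then show ?thesis
    unfolding span_eq using assms by (simp add: span_base span_mul)
qed

text \<open>On real vectors all three forms are real, so taking real parts turns complex
  coefficients into real ones.\<close>

lemma qf_scaled_if_cform_scaled:
  assumes "\<And>z. cform C z = k * cform A z + m * cform B z"
  shows "qf C x x = Re k * qf A x x + Re m * qf B x x"
  using arg_cong[OF assms[of "\<chi> i. of_real (x $ i)"], of Re] unfolding cform_of_real by simp

lemma span_eq_if_cform_scaled:
  assumes "transpose A = A" "transpose B = B" "B \<noteq> 0" "\<And>z. cform B z = k * cform A z"
  shows "span {A} = span {B}"
proof -
  have q: "qf B x x = Re k * qf A x x" for x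
    using qf_scaled_if_cform_scaled[of B k A 0 A] assms(4) by simp
  have "B - Re k *\<^sub>R A = 0"
    by (rule sym_eq_0_if_qf_0) (use assms(1,2) in \<open>simp_all add: transpose_eq_iff qf_diff qf_scaleR q\<close>)
  then have B: "B = Re k *\<^sub>R A" by simp
  with assms(3) have "Re k \<noteq> 0" by auto
  then show ?thesis unfolding B by (simp add: span_scaleR_singleton)
qed

lemma pencil_if_contains_intersection:
  assumes A: "irreducible_conic A" and B: "irreducible_conic B" and C: "transpose C = C"
    and I: "contains_intersection C A B" and ne: "span {A} \<noteq> span {B}"
  obtains l m where "\<And>x. qf C x x = l * qf A x x + m * qf B x x"
proof -
  have sA: "transpose A = A" and sB: "transpose B = B" and B0: "B \<noteq> 0"
    using A B by (simp_all add: irreducible_conic_def conic_def)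
  let ?M = "cmat A" and ?B = "cmat B" and ?C = "cmat C"
  note M = cmat_sym[OF sA] and BS = cmat_sym[OF sB] and CS = cmat_sym[OF C]
  note nd = cbf_cmat_nondegenerate[OF A]
  have param_A: "cbf ?M (conic_param p u w x) (conic_param p u w x) = 0"
    if "cbf ?M p p = 0" "cbf ?M u u = 0" "cbf ?M p u = 1" "cbf ?M p w = 0" "cbf ?M u w = 0" "cbf ?M w w = 1"
    for p u w x
    unfolding poly_param_poly[OF M, symmetric] by (simp add: param_poly_def that)
  \<comment> \<open>An arbitrary point of \<open>A\<close> may lie on \<open>B\<close>. The conic is
    first parametrized from such a point: the pullback of \<open>B\<close> is nonzero, as otherwise
    \<open>B\<close> would be a multiple of \<open>A\<close>, and any parameter where it does not
    vanish gives a point off \<open>B\<close>.\<close>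
  obtain p where p: "p \<noteq> 0" "cbf ?M p p = 0" "cbf ?B p p \<noteq> 0"
  proof -
    obtain p where p: "p \<noteq> 0" "cbf ?M p p = 0"
      using conic_has_complex_point[of A] unfolding cform_eq_cbf by blast
    obtain u w where b: "cbf ?M u u = 0" "cbf ?M p u = 1" "cbf ?M p w = 0" "cbf ?M u w = 0" "cbf ?M w w = 1"
      "\<And>z. z = cbf ?M z u *s p + cbf ?M z p *s u + cbf ?M z w *s w"
      using conic_basis[OF M nd p] by blast
    have "param_poly ?B p u w \<noteq> 0"
    proof
      assume "param_poly ?B p u w = 0"
      then have "cform B z = cbf ?B p u * cform A z" for z
        unfolding cform_eq_cbf by (rule form_multiple_if_param_poly_0[OF M BS b(1,2) p(2) b(3-6)])
      then show False using span_eq_if_cform_scaled[OF sA sB B0] ne by blast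
    qed
    then obtain x where "poly (param_poly ?B p u w) x \<noteq> 0"
      using poly_all_0_iff_0 by blast
    then have *: "cbf ?B (conic_param p u w x) (conic_param p u w x) \<noteq> 0"
      by (simp add: poly_param_poly[OF BS])
    then have "conic_param p u w x \<noteq> 0" by (metis cbf_zero(1))
    with * show ?thesis using that param_A[OF p(2) b(1-5)] by blast
  qed
  obtain u w where b: "cbf ?M u u = 0" "cbf ?M p u = 1" "cbf ?M p w = 0" "cbf ?M u w = 0" "cbf ?M w w = 1"
    "\<And>z. z = cbf ?M z u *s p + cbf ?M z p *s u + cbf ?M z w *s w"
    using conic_basis[OF M nd p(1,2)] by blast
  define z where "z = conic_param p u w"
  define qB where "qB = param_poly ?B p u w"
  define qC where "qC = param_poly ?C p u w"
  have qBx: "poly qB x = cform B (z x)" and qCx: "poly qC x = cform C (z x)" for x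
    unfolding qB_def qC_def z_def cform_eq_cbf by (simp_all add: poly_param_poly BS CS)
  have dB: "degree qB = 4" and dC: "degree qC \<le> 4"
    using p(3) by (simp_all add: qB_def qC_def param_poly_def degree_pCons_le)
  have "qB dvd qC"
  proof (rule poly_dvd_if_locally_dvd)
    show "qB \<noteq> 0" using dB by auto
    fix x assume x: "poly qB x = 0"
    \<comment> \<open>The \<open>u\<close>-coordinate of the parametrization is constantly -2, so it
      never takes the value zero.\<close>
    have "cbf ?M p (z x) = - 2"
      by (simp add: z_def conic_param_def cbf_diff cbf_scale p b)
    then have "z x \<noteq> 0" by auto
    moreover have Az: "cform A (z y) = 0" for y
      unfolding cform_eq_cbf z_def by (rule param_A[OF p(2) b(1-5)])
    moreover have "cform B (z x) = 0" using x qBx by simp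
    ultimately obtain f g h where fgh: "cpolynomial g" "cpolynomial h" "h (z x) \<noteq> 0"
      "\<And>y. h y * cform C y = f y * cform A y + g y * cform B y"
      using I unfolding contains_intersection_def by metis
    obtain g' h' where g': "\<And>y. g (z y) = poly g' y" and h': "\<And>y. h (z y) = poly h' y"
      using cpolynomial_param fgh(1,2) unfolding z_def by metis
    \<comment> \<open>On the conic the term with \<open>A\<close> drops out, and ideal membership
      becomes divisibility up to the local unit \<open>h'\<close>.\<close>
    have "poly (h' * qC) y = poly (g' * qB) y" for y
      using fgh(4)[of "z y"] by (simp add: Az g' h' qBx qCx)
    then have "h' * qC = g' * qB" by (simp add: poly_eq_poly_eq_iff[symmetric] fun_eq_iff)
    moreover have "poly h' x \<noteq> 0" using fgh(3) h' by simp
    ultimately show "\<exists>g h. poly h x \<noteq> 0 \<and> h * qC = g * qB" by blast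
  qed
  then obtain r where r: "qC = qB * r" ..
  have "degree r = 0"
  proof (cases "r = 0")
    case False
    with dB have "degree qC = 4 + degree r" unfolding r by (subst degree_mult_eq) auto
    with dC show ?thesis by simp
  qed simp
  then obtain m where m: "r = [:m:]" by (rule degree_eq_zeroE)
  \<comment> \<open>The complex form \<open>C - m B\<close>; its pullback to the conic vanishes,
    which makes it a multiple of \<open>A\<close>.\<close>
  define D where "D = (\<chi> i j. ?C $ i $ j - m * ?B $ i $ j)"
  have D: "cbf D x y = cbf ?C x y - m * cbf ?B x y" for x y
    by (simp add: D_def cbf_def sum_3 algebra_simps)
  have DS: "transpose D = D" using BS CS by (simp add: transpose_eq_iff D_def)
  have "poly (param_poly D p u w) x = 0" for x
    unfolding poly_param_poly[OF DS] D using qBx[of x] qCx[of x]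
    by (simp add: z_def cform_eq_cbf r m)
  then have "param_poly D p u w = 0" using poly_all_0_iff_0 by blast
  then have "cbf D y y = cbf D p u * cbf ?M y y" for y
    by (rule form_multiple_if_param_poly_0[OF M DS b(1,2) p(2) b(3-6)])
  then have "cform C y = cbf D p u * cform A y + m * cform B y" for y
    unfolding cform_eq_cbf D by (simp add: algebra_simps)
  from that[OF qf_scaled_if_cform_scaled[OF this]] show ?thesis .
qed

text \<open>The same constants \<open>l\<close>, \<open>m\<close> and the denominator 1 serve at
  every point.\<close>

lemma contains_intersection_pencil: "contains_intersection (l *\<^sub>R A + m *\<^sub>R B) A B"
  unfolding contains_intersection_def
proof (intro allI impI exI conjI)
  fix z :: "complex^3"
  show "1 * cform (l *\<^sub>R A + m *\<^sub>R B) z = of_real l * cform A z + of_real m * cform B z"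
    by (simp add: cform_def sum_3 algebra_simps)
qed (auto intro: cpolynomial.const)

section \<open>The determinant criterion for a member of the pencil through \<open>a\<close> and
  \<open>b\<close>\<close>

definition qexpr :: "real^3 \<Rightarrow> real^3^3 \<Rightarrow> real^3 \<Rightarrow> real^3^3 \<Rightarrow> real" where
  "qexpr a A b B = qf A a a * qf B b b - qf B a a * qf A b b"

lemma qexpr_0_if_span_eq:
  assumes "span {A} = span {B}"
  shows "qexpr a A b B = 0"
proof -
  have "B \<in> span {A}" unfolding assms by (simp add: span_base)
  then obtain k where "B = k *\<^sub>R A" by (auto simp: span_singleton)
  then show ?thesis by (simp add: qexpr_def qf_scaleR)
qed

lemma conic_through_iff_qexpr:
  assumes A: "irreducible_conic A" and B: "irreducible_conic B" and ne: "span {A} \<noteq> span {B}"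
  shows "(\<exists>C. conic_through C (a, A) (b, B)) \<longleftrightarrow> qexpr a A b B = 0"
proof
  have sA: "transpose A = A" "A \<noteq> 0" and sB: "transpose B = B"
    using A B by (simp_all add: irreducible_conic_def conic_def)
  {
    assume "\<exists>C. conic_through C (a, A) (b, B)"
    then obtain C where C: "transpose C = C" "C \<noteq> 0" "qf C a a = 0" "qf C b b = 0" "contains_intersection C A B"
      by (auto simp: conic_through_def conic_def qf_def)
    obtain l m where lm: "\<And>x. qf C x x = l * qf A x x + m * qf B x x"
      using pencil_if_contains_intersection[OF A B C(1,5) ne] by blast
    have "l * qf A a a + m * qf B a a = 0" "l * qf A b b + m * qf B b b = 0"
      using lm C(3,4) by metis+
    \<comment> \<open>Cramer's rule: the determinant kills both unknowns.\<close>
    then have "l * qexpr a A b B = 0" "m * qexpr a A b B = 0"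
      unfolding qexpr_def by algebra+
    moreover have "l \<noteq> 0 \<or> m \<noteq> 0"
      using sym_eq_0_if_qf_0[OF C(1)] C(2) lm by auto
    ultimately show "qexpr a A b B = 0" by auto
  }
  assume q: "qexpr a A b B = 0"
  \<comment> \<open>A nonzero row of the singular system, with its entries swapped and one sign
    changed, is a nontrivial solution; if both rows vanish, any pair will do.\<close>
  obtain l m where lm: "l \<noteq> 0 \<or> m \<noteq> 0" "l * qf A a a + m * qf B a a = 0" "l * qf A b b + m * qf B b b = 0"
  proof (cases "qf A a a = 0 \<and> qf B a a = 0")
    case True
    show ?thesis
    proof (cases "qf A b b = 0 \<and> qf B b b = 0")
      case True
      with \<open>qf A a a = 0 \<and> qf B a a = 0\<close> show ?thesis using that[of 1 0] by simp
    next
      case False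
      with True show ?thesis using that[of "qf B b b" "- qf A b b"] by auto
    qed
  next
    case False
    with q show ?thesis using that[of "qf B a a" "- qf A a a"] by (auto simp: qexpr_def algebra_simps)
  qed
  let ?C = "l *\<^sub>R A + m *\<^sub>R B"
  have "?C \<noteq> 0"
  proof
    \<comment> \<open>A vanishing nontrivial combination would make \<open>A\<close> and
      \<open>B\<close> proportional.\<close>
    assume C0: "?C = 0"
    have "m \<noteq> 0" using C0 lm(1) sA(2) by auto
    from C0 have "m *\<^sub>R B = (- l) *\<^sub>R A" by (simp add: add_eq_0_iff)
    then have "(1 / m) *\<^sub>R m *\<^sub>R B = (1 / m) *\<^sub>R (- l) *\<^sub>R A" by simp
    with \<open>m \<noteq> 0\<close> have Bk: "B = (- l / m) *\<^sub>R A" by simp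
    moreover have "B \<noteq> 0" using B by (simp add: irreducible_conic_def conic_def)
    ultimately have "- l / m \<noteq> 0" by auto
    then show False using ne span_scaleR_singleton[of "- l / m" A] Bk by simp
  qed
  then have "conic_through ?C (a, A) (b, B)"
    using sA sB lm contains_intersection_pencil[of l A m B]
    by (auto simp: conic_through_def conic_def transpose_eq_iff qf_def[symmetric] qf_add qf_scaleR)
  then show "\<exists>C. conic_through C (a, A) (b, B)" ..
qed

subsection \<open>The image of the projection\<close>

lemma span_singleton_eqD:
  fixes x y :: "'a::real_vector"
  assumes "span {x} = span {y}" "y \<noteq> 0"
  obtains k where "k \<noteq> 0" "x = k *\<^sub>R y"
proof -
  have "y \<in> span {x}" "x \<in> span {y}" using assms(1) span_base by blast+
  then obtain k where k: "x = k *\<^sub>R y" by (auto simp: span_singleton)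
  have "k \<noteq> 0"
  proof
    assume "k = 0"
    with k \<open>y \<in> span {x}\<close> assms(2) show False by (simp add: span_singleton)
  qed
  with that k show ?thesis by blast
qed

lemma irreducible_conic_scaleR:
  assumes "irreducible_conic A" "k \<noteq> 0"
  shows "irreducible_conic (k *\<^sub>R A)"
proof -
  have "det (k *\<^sub>R A) = k ^ 3 * det A"
    by (simp add: det_3 power3_eq_cube algebra_simps)
  with assms show ?thesis
    by (simp add: irreducible_conic_iff_det transpose_eq_iff)
qed

text \<open>Representatives of the same class differ by nonzero factors and the conditions are
  homogeneous, so membership may be tested on any representative.\<close>

lemma proj_class_in_N_iff:
  "proj_class (a, A) \<in> N \<longleftrightarrow> a \<noteq> 0 \<and> irreducible_conic A \<and> qf A a a \<noteq> 0"
proof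
  assume "proj_class (a, A) \<in> N"
  then obtain b B where b: "span {a} = span {b}" "span {A} = span {B}" "b \<noteq> 0" "irreducible_conic B" "qf B b b \<noteq> 0"
    by (auto simp: N_def proj_class_def qf_def)
  have "B \<noteq> 0" using b(4) by (simp add: irreducible_conic_def conic_def)
  obtain k m where "k \<noteq> 0" "a = k *\<^sub>R b" "m \<noteq> 0" "A = m *\<^sub>R B"
    using span_singleton_eqD[OF b(1,3)] span_singleton_eqD[OF b(2) \<open>B \<noteq> 0\<close>] by metis
  then show "a \<noteq> 0 \<and> irreducible_conic A \<and> qf A a a \<noteq> 0"
    using b by (simp add: irreducible_conic_scaleR qf_scaleR)
qed (auto simp: N_def qf_def)

lemma sym_iff_qf: "transpose A = A \<longleftrightarrow> (\<forall>x y. qf A x y = qf A y x)"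
proof (safe)
  assume s: "\<forall>x y. qf A x y = qf A y x"
  have "A $ i $ j = qf A (axis i 1) (axis j 1)" for i j
    by (simp add: qf_def matrix_vector_mult_basis inner_axis' column_def)
  with s show "transpose A = A" by (simp add: transpose_eq_iff)
qed (rule qf_sym)

lemma sym_matrix_with_polar:
  fixes a m :: "real^3"
  assumes "m \<bullet> a = 1"
  shows "\<exists>A. transpose A = A \<and> det A \<noteq> 0 \<and> A *v a = m"
proof -
  \<comment> \<open>\<open>A = m m\<^sup>T + P\<^sup>T P\<close> with \<open>P\<close> the projection along \<open>a\<close> onto the kernel of \<open>m\<close>\<close>
  define f where "f y = (m \<bullet> y) *\<^sub>R m + (y - (m \<bullet> y) *\<^sub>R a) - ((y - (m \<bullet> y) *\<^sub>R a) \<bullet> a) *\<^sub>R m" for y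
  have "linear f"
    unfolding f_def by (rule linearI) (simp_all add: algebra_simps inner_simps)
  define A where "A = matrix f"
  have A: "A *v y = f y" for y
    unfolding A_def using matrix_vector_mul(2)[OF \<open>linear f\<close>] by metis
  have q: "qf A x y = (m \<bullet> x) * (m \<bullet> y) + (x - (m \<bullet> x) *\<^sub>R a) \<bullet> (y - (m \<bullet> y) *\<^sub>R a)" for x y
    unfolding qf_def A f_def by (simp add: inner_simps inner_commute[of _ m] inner_commute[of y a] algebra_simps)
  have "transpose A = A" unfolding sym_iff_qf q by (simp add: inner_commute)
  moreover have "det A \<noteq> 0"
    unfolding det_nonzero_iff_kernel
  proof (intro allI impI)
    fix z assume "A *v z = 0"
    \<comment> \<open>The form is positive definite: a sum of two squares that vanish together only
      at zero.\<close>
    then have "qf A z z = 0" by (simp add: qf_def)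
    then have z: "(m \<bullet> z)^2 + (norm (z - (m \<bullet> z) *\<^sub>R a))^2 = 0"
      unfolding power2_norm_eq_inner q by (simp only: power2_eq_square)
    then have "m \<bullet> z = 0" "norm (z - (m \<bullet> z) *\<^sub>R a) = 0"
      using sum_power2_eq_zero_iff[of "m \<bullet> z" "norm (z - (m \<bullet> z) *\<^sub>R a)"] by blast+
    then show "z = 0" by simp
  qed
  moreover have "A *v a = m" using assms by (simp add: A f_def)
  ultimately show ?thesis by blast
qed

section \<open>Points and lines of the projective plane as spans and hyperplanes\<close>

lemma proj_points_eq: "proj_points = {span {a} | a. a \<noteq> 0}"
proof (intro set_eqI iffI)
  fix L :: "(real^3) set" assume L: "L \<in> proj_points"
  then obtain B where B: "independent B" "span B = L" "card B = 1"
    unfolding proj_points_def by (metis (mono_tags, lifting) basis_exists mem_Collect_eq span_subspace)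
  then obtain a where "B = {a}" by (meson card_1_singletonE)
  with B show "L \<in> {span {a} | a. a \<noteq> 0}" by auto
next
  fix L :: "(real^3) set" assume "L \<in> {span {a} | a. a \<noteq> 0}"
  then obtain a where "L = span {a}" "a \<noteq> 0" by blast
  then show "L \<in> proj_points" by (simp add: proj_points_def dim_eq_card_independent)
qed

lemma proj_lines_eq: "proj_lines = {{z. m \<bullet> z = 0} | m. m \<noteq> 0}"
proof (intro set_eqI iffI)
  fix M :: "(real^3) set" assume M: "M \<in> proj_lines"
  then have "subspace M" "dim M = DIM(real^3) - 1" by (auto simp: proj_lines_def)
  then obtain m where "m \<noteq> 0" "M = {z. m \<bullet> z = 0}"
    by (metis lowdim_eq_hyperplane span_eq_iff)
  then show "M \<in> {{z. m \<bullet> z = 0} | m. m \<noteq> 0}" by blast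
next
  fix M :: "(real^3) set" assume "M \<in> {{z. m \<bullet> z = 0} | m. m \<noteq> 0}"
  then show "M \<in> proj_lines" by (auto simp: proj_lines_def subspace_hyperplane dim_hyperplane)
qed

lemma polar_eq_hyperplane:
  fixes A :: "real^3^3"
  assumes "transpose A = A"
  shows "{z. a \<bullet> (A *v z) = 0} = {z. (A *v a) \<bullet> z = 0}"
  using qf_sym[OF assms, of a] by (simp add: qf_def inner_commute)

text \<open>The polar line has normal \<open>A *v a\<close>, so it misses \<open>a\<close> exactly
  when \<open>qf A a a\<close> is nonzero. For surjectivity the normal of a given line is scaled to
  have product 1 with \<open>a\<close> and then realized as \<open>A *v a\<close>.\<close>

lemma image_polar_projection: "polar_projection ` N = proj_points \<times> proj_lines - incident_pairs"
proof (intro equalityI subsetI)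
  fix q assume "q \<in> polar_projection ` N"
  then obtain a A where aA: "a \<noteq> 0" "irreducible_conic A" "qf A a a \<noteq> 0" 
    and q: "q = polar_projection (proj_class (a, A))"
    by (auto simp: N_def qf_def)
  have "transpose A = A" using aA by (simp add: irreducible_conic_iff_det)
  then have q: "q = (span {a}, {z. (A *v a) \<bullet> z = 0})"
    unfolding q polar_projection_proj_class by (simp add: polar_eq_hyperplane)
  have "A *v a \<noteq> 0" using aA by (auto simp: qf_def)
  moreover have "a \<notin> {z. (A *v a) \<bullet> z = 0}" using aA(3) by (simp add: qf_def inner_commute)
  then have "\<not> span {a} \<subseteq> {z. (A *v a) \<bullet> z = 0}" using span_base[of a "{a}"] by blast
  ultimately show "q \<in> proj_points \<times> proj_lines - incident_pairs"
    unfolding q incident_pairs_def proj_points_eq proj_lines_eq using aA(1) by auto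
next
  fix q assume q: "q \<in> proj_points \<times> proj_lines - incident_pairs"
  then obtain L M where LM: "q = (L, M)" "L \<in> proj_points" "M \<in> proj_lines" "\<not> L \<subseteq> M"
    by (auto simp: incident_pairs_def)
  then obtain a m where a: "L = span {a}" "a \<noteq> 0" and m: "M = {z. m \<bullet> z = 0}" "m \<noteq> 0"
    by (auto simp: proj_points_eq proj_lines_eq)
  have "m \<bullet> a \<noteq> 0"
    using LM(4) unfolding a m by (auto simp: span_singleton)
  then have "((1 / (m \<bullet> a)) *\<^sub>R m) \<bullet> a = 1" by simp
  then obtain A where A: "transpose A = A" "det A \<noteq> 0" "A *v a = (1 / (m \<bullet> a)) *\<^sub>R m"
    using sym_matrix_with_polar by blast
  have "qf A a a = 1" using A(3) \<open>m \<bullet> a \<noteq> 0\<close> by (simp add: qf_def inner_commute)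
  then have "proj_class (a, A) \<in> N"
    using A a by (simp add: proj_class_in_N_iff irreducible_conic_iff_det)
  moreover have "polar_projection (proj_class (a, A)) = q"
    unfolding polar_projection_proj_class polar_eq_hyperplane[OF A(1)] LM a m
    using A(3) \<open>m \<bullet> a \<noteq> 0\<close> by simp
  ultimately show "q \<in> polar_projection ` N" by (metis image_eqI)
qed

subsection \<open>The dancing form\<close>

text \<open>The second-order coefficient of the dancing expression, written without assuming
  symmetry; hence both orders of the arguments occur.\<close>

definition dform :: "real^3 \<Rightarrow> real^3^3 \<Rightarrow> rep \<Rightarrow> real" where
  "dform a A v = qf A a a * (qf (snd v) a (fst v) + qf (snd v) (fst v) a)
     - qf (snd v) a a * (qf A a (fst v) + qf A (fst v) a)"

lemma dancing_expr_eq: "dancing_expr (a, A) (b, B) = qexpr a A b B"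
  by (simp add: qexpr_def qf_def)

text \<open>The terms of order 0 and 1 cancel between the two products, so the expansion starts in
  degree 2.\<close>

lemma dancing_expr_line:
  "dancing_expr (a, A) ((a, A) + t *\<^sub>R v) =
     dform a A v * t^2 + (qf A a a * qf (snd v) (fst v) (fst v) - qf (snd v) a a * qf A (fst v) (fst v)) * t^3"
  by (cases v) (simp add: dancing_expr_eq qexpr_def dform_def qf_add qf_scaleR power2_eq_square power3_eq_cube algebra_simps
       del: dancing_expr.simps)

lemma
  fixes c d :: real
  shows deriv_cubic: "deriv (\<lambda>t. c * t^2 + d * t^3) = (\<lambda>t. 2 * c * t + 3 * d * t^2)"
    and deriv2_cubic: "(deriv ^^ 2) (\<lambda>t. c * t^2 + d * t^3) 0 = 2 * c"
proof -
  show 1: "deriv (\<lambda>t. c * t^2 + d * t^3) = (\<lambda>t. 2 * c * t + 3 * d * t^2)"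
    by (intro ext DERIV_imp_deriv) (auto intro!: derivative_eq_intros)
  show "(deriv ^^ 2) (\<lambda>t. c * t^2 + d * t^3) 0 = 2 * c"
    unfolding numeral_2_eq_2 funpow.simps o_def id_def 1[unfolded numeral_2_eq_2]
    by (rule DERIV_imp_deriv) (auto intro!: derivative_eq_intros)
qed

lemma dancing_form_eq: "dancing_form (a, A) v = dform a A v"
  unfolding dancing_form_def dancing_expr_line deriv2_cubic by simp

lemma deriv_dancing_expr: "deriv (\<lambda>t. dancing_expr (a, A) ((a, A) + t *\<^sub>R v)) 0 = 0"
  unfolding dancing_expr_line deriv_cubic by simp

section \<open>Smooth dependence, polarization and scaling of the dancing form\<close>

lemma real_polynomial_function_qf:
  assumes "bounded_linear F" "bounded_linear g" "bounded_linear h"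
  shows "real_polynomial_function (\<lambda>x. qf (F x) (g x) (h x))"
  unfolding qf_sum sum_3
  by (intro real_polynomial_function.intros(3) real_polynomial_function.intros(4) real_polynomial_function.intros(1)
      bounded_linear_compose[OF bounded_linear_vec_nth] assms)

text \<open>Being polynomial in the base point and the vector jointly, the form varies smoothly with
  the point.\<close>

lemma real_polynomial_function_dancing_form:
  "real_polynomial_function (\<lambda>(p, v). dancing_form p v)"
proof -
  note bl = bounded_linear_fst bounded_linear_snd bounded_linear_compose[OF bounded_linear_fst]
    bounded_linear_compose[OF bounded_linear_snd]
  have *: "(\<lambda>(p, v). dancing_form p v) = (\<lambda>x. dform (fst (fst x)) (snd (fst x)) (snd x))"
    by (simp add: fun_eq_iff dancing_form_eq)
  show ?thesis
    unfolding * dform_def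
    by (intro real_polynomial_function.intros(3) real_polynomial_function.intros(4) real_polynomial_function_diff
      real_polynomial_function_qf bl)
qed

definition dpol :: "real^3 \<Rightarrow> real^3^3 \<Rightarrow> rep \<Rightarrow> rep \<Rightarrow> real" where
  "dpol a A v w = (qf A a a * (qf (snd v) a (fst w) + qf (snd v) (fst w) a + qf (snd w) a (fst v) + qf (snd w) (fst v) a)
     - qf (snd v) a a * (qf A a (fst w) + qf A (fst w) a)
     - qf (snd w) a a * (qf A a (fst v) + qf A (fst v) a)) / 2"

lemma polarization_dancing_form: "polarization (dancing_form (a, A)) v w = dpol a A v w"
  by (simp add: polarization_def dancing_form_eq dform_def dpol_def qf_add algebra_simps)

lemma quadratic_form_dancing_form: "quadratic_form (dancing_form (a, A))"
  unfolding quadratic_form_def bilinear_def polarization_dancing_form linear_iff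
  by (auto simp: dpol_def dancing_form_eq dform_def qf_add qf_scaleR field_simps)

text \<open>Each term has total degree four in the vectors and two in the matrices. Both exponents
  are even, so nonzero \<open>c\<close> and \<open>d\<close> give a positive factor: the conformal
  class is independent of the representatives.\<close>

lemma dancing_form_scale:
  "dancing_form (c *\<^sub>R a, d *\<^sub>R A) (c *\<^sub>R fst v, d *\<^sub>R snd v) = (c ^ 4 * d ^ 2) * dancing_form (a, A) v"
  by (simp add: dancing_form_eq dform_def qf_scaleR power2_eq_square power4_eq_xxxx algebra_simps)

subsection \<open>Tangent vectors and the radical\<close>

text \<open>Velocities inherit every linear equation that holds along the curve near 0; this bounds
  tangent spaces from above.\<close>

lemma derivative_in_kernel:
  assumes \<gamma>: "(\<gamma> has_vector_derivative v) (at (0::real))" and f: "bounded_linear f"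
    and z: "\<forall>\<^sub>F t in nhds 0. f (\<gamma> t) = 0"
  shows "f v = 0"
proof -
  have 1: "((\<lambda>t. f (\<gamma> t)) has_vector_derivative f v) (at 0)"
    by (rule bounded_linear.has_vector_derivative[OF f \<gamma>])
  obtain S where S: "open S" "0 \<in> S" "\<And>t. t \<in> S \<Longrightarrow> f (\<gamma> t) = 0"
    using z unfolding eventually_nhds by blast
  have "((\<lambda>t. 0) has_vector_derivative f v) (at 0)"
    by (rule has_vector_derivative_transform_within_open[OF 1 S(1,2)]) (simp add: S(3))
  then show ?thesis
    by (metis has_vector_derivative_const vector_derivative_unique_at)
qed

lemma line_has_vector_derivative: "((\<lambda>t. p + t *\<^sub>R v) has_vector_derivative v) (at t)"
  by (auto intro!: derivative_eq_intros)

lemma tangent_liftsI: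
  assumes "\<forall>\<^sub>F t in nhds 0. proj_class (p + t *\<^sub>R v) \<in> M"
  shows "v \<in> tangent_lifts M p"
  unfolding tangent_lifts_def using assms line_has_vector_derivative[of p v 0]
  by (intro CollectI exI[of _ "\<lambda>t. p + t *\<^sub>R v"]) simp

text \<open>Among pairs with symmetric matrix, \<open>N\<close> is cut out by two nonvanishing
  conditions on polynomials in \<open>t\<close>, which persist for small \<open>t\<close>.\<close>

lemma eventually_line_in_N:
  assumes N: "proj_class (a, A) \<in> N" and v: "transpose (snd v) = snd v"
  shows "\<forall>\<^sub>F t in nhds 0. proj_class ((a, A) + t *\<^sub>R v) \<in> N"
proof -
  obtain u V where uV: "v = (u, V)" by (cases v)
  have A: "transpose A = A" "det A \<noteq> 0" "qf A a a \<noteq> 0"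
    using N by (simp_all add: proj_class_in_N_iff irreducible_conic_iff_det)
  let ?d = "\<lambda>t. det (A + t *\<^sub>R V)" and ?q = "\<lambda>t. qf (A + t *\<^sub>R V) (a + t *\<^sub>R u) (a + t *\<^sub>R u)"
  have "(?d \<longlongrightarrow> ?d 0) (nhds 0)" "(?q \<longlongrightarrow> ?q 0) (nhds 0)"
    unfolding det_3 qf_sum sum_3 by (intro tendsto_intros filterlim_ident)+
  then have "\<forall>\<^sub>F t in nhds 0. ?d t \<noteq> 0" "\<forall>\<^sub>F t in nhds 0. ?q t \<noteq> 0"
    using A by (auto intro!: tendsto_imp_eventually_ne)
  then show ?thesis
  proof eventually_elim
    case (elim t)
    moreover have "a + t *\<^sub>R u \<noteq> 0" using elim(2) by auto
    moreover have "transpose (A + t *\<^sub>R V) = A + t *\<^sub>R V"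
      using A(1) v by (simp add: uV transpose_eq_iff)
    ultimately show ?case
      by (simp add: uV proj_class_in_N_iff irreducible_conic_iff_det)
  qed
qed

lemma tangent_lifts_N:
  assumes "proj_class (a, A) \<in> N"
  shows "tangent_lifts N (a, A) = {v :: rep. transpose (snd v) = snd v}"
proof (intro equalityI subsetI CollectI)
  fix v assume "v \<in> tangent_lifts N (a, A)"
  then obtain \<gamma> where \<gamma>: "(\<gamma> has_vector_derivative v) (at 0)" "\<forall>\<^sub>F t in nhds 0. proj_class (\<gamma> t) \<in> N"
    by (auto simp: tangent_lifts_def)
  have "snd v $ i $ j - snd v $ j $ i = 0" for i j
  proof (rule derivative_in_kernel[OF \<gamma>(1)])
    show "bounded_linear (\<lambda>v. snd v $ i $ j - snd v $ j $ i)"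
      by (intro bounded_linear_sub bounded_linear_compose[OF bounded_linear_vec_nth] bounded_linear_snd)
    show "\<forall>\<^sub>F t in nhds 0. snd (\<gamma> t) $ i $ j - snd (\<gamma> t) $ j $ i = 0"
      using \<gamma>(2)
    proof eventually_elim
      case (elim t)
      then have "transpose (snd (\<gamma> t)) = snd (\<gamma> t)"
        by (metis prod.collapse proj_class_in_N_iff irreducible_conic_iff_det)
      then show ?case by (simp add: transpose_eq_iff)
    qed
  qed
  then show "transpose (snd v) = snd v" by (simp add: transpose_eq_iff)
next
  fix v assume "v \<in> {v :: rep. transpose (snd v) = snd v}"
  with assms show "v \<in> tangent_lifts N (a, A)"
    by (intro tangent_liftsI eventually_line_in_N) auto
qed

text \<open>After removal of its projection onto \<open>n\<close>, the vector \<open>x\<close>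
  leaves a remainder orthogonal to \<open>n\<close> and to \<open>x\<close>, hence to
  itself.\<close>

lemma parallel_if_perp:
  fixes n x :: "'a::real_inner"
  assumes "n \<noteq> 0" "\<And>y. y \<bullet> n = 0 \<Longrightarrow> y \<bullet> x = 0"
  shows "\<exists>c. x = c *\<^sub>R n"
proof -
  define y where "y = x - ((x \<bullet> n) / (n \<bullet> n)) *\<^sub>R n"
  have yn: "y \<bullet> n = 0" using assms(1) by (simp add: y_def inner_simps)
  then have "y \<bullet> x = 0" by (rule assms(2))
  with yn have "y \<bullet> y = 0" by (simp add: y_def inner_simps)
  then have "x = ((x \<bullet> n) / (n \<bullet> n)) *\<^sub>R n" by (simp add: y_def)
  then show ?thesis ..
qed

lemma hyperplane_eqD:
  fixes m n :: "'a::real_inner"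
  assumes "{z. m \<bullet> z = 0} = {z. n \<bullet> z = 0}" "y \<bullet> n = 0"
  shows "y \<bullet> m = 0"
  using assms by (auto simp: set_eq_iff inner_commute)

text \<open>Along a curve in the fibre the point and its polar line are fixed, which gives linear
  equations for the velocity. Conversely, a vector satisfying them has its straight line inside the
  fibre for small parameters.\<close>

lemma tangent_lifts_polar_fibre:
  assumes N: "proj_class (a, A) \<in> N"
  shows "tangent_lifts (polar_fibre (a, A)) (a, A) =
    {v :: rep. transpose (snd v) = snd v \<and> (\<exists>c. fst v = c *\<^sub>R a) \<and> (\<exists>s. snd v *v a = s *\<^sub>R (A *v a))}"
    (is "_ = ?R")
proof -
  have A: "transpose A = A" "qf A a a \<noteq> 0" "a \<noteq> 0" "A *v a \<noteq> 0"
    using N by (auto simp: proj_class_in_N_iff irreducible_conic_iff_det qf_def)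
  have fibre: "proj_class (b, B) \<in> polar_fibre (a, A) \<longleftrightarrow>
      proj_class (b, B) \<in> N \<and> span {b} = span {a} \<and> {z. (B *v b) \<bullet> z = 0} = {z. (A *v a) \<bullet> z = 0}" for b B
  proof -
    have "transpose B = B" if "proj_class (b, B) \<in> N"
      using that by (simp add: proj_class_in_N_iff irreducible_conic_iff_det)
    then show ?thesis
      unfolding polar_fibre_def mem_Collect_eq polar_projection_proj_class
      by (cases "proj_class (b, B) \<in> N") (simp_all add: polar_eq_hyperplane A(1))
  qed
  show ?thesis
  proof (intro equalityI subsetI)
    fix v assume "v \<in> tangent_lifts (polar_fibre (a, A)) (a, A)"
    then obtain \<gamma> where \<gamma>: "\<gamma> 0 = (a, A)" "(\<gamma> has_vector_derivative v) (at 0)"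
        "\<forall>\<^sub>F t in nhds 0. proj_class (\<gamma> t) \<in> polar_fibre (a, A)"
      by (auto simp: tangent_lifts_def)
    have "\<forall>\<^sub>F t in nhds 0. proj_class (\<gamma> t) \<in> N"
      using \<gamma>(3) by eventually_elim (simp add: polar_fibre_def)
    with \<gamma> have "v \<in> tangent_lifts N (a, A)" by (auto simp: tangent_lifts_def)
    then have "transpose (snd v) = snd v" by (simp add: tangent_lifts_N[OF N])
    \<comment> \<open>The moving vector is a multiple of \<open>a\<close>, so the polar condition
      can be evaluated at the fixed \<open>a\<close>, where it is linear in the matrix.\<close>
    moreover have ev: "\<forall>\<^sub>F t in nhds 0. (\<exists>k. k \<noteq> 0 \<and> fst (\<gamma> t) = k *\<^sub>R a) \<and>
        (\<forall>y. y \<bullet> (A *v a) = 0 \<longrightarrow> y \<bullet> (snd (\<gamma> t) *v a) = 0)"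
      using \<gamma>(3)
    proof eventually_elim
      case (elim t)
      obtain b B where bB: "\<gamma> t = (b, B)" by (cases "\<gamma> t")
      have e: "span {b} = span {a}" "{z. (B *v b) \<bullet> z = 0} = {z. (A *v a) \<bullet> z = 0}"
        using elim unfolding bB fibre by simp_all
      obtain k where k: "k \<noteq> 0" "b = k *\<^sub>R a" using span_singleton_eqD[OF e(1) A(3)] .
      have "y \<bullet> (B *v a) = 0" if "y \<bullet> (A *v a) = 0" for y
        using hyperplane_eqD[OF e(2) that] k by (simp add: matrix_vector_mult_scaleR)
      with k show ?case by (auto simp: bB)
    qed
    moreover have "y \<bullet> fst v = 0" if "y \<bullet> a = 0" for y
    proof (rule derivative_in_kernel[OF \<gamma>(2)])
      show "bounded_linear (\<lambda>v. y \<bullet> fst v)"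
        by (intro bounded_linear_inner_right_comp bounded_linear_fst)
      show "\<forall>\<^sub>F t in nhds 0. y \<bullet> fst (\<gamma> t) = 0"
        using ev by eventually_elim (use that in auto)
    qed
    then have "\<exists>c. fst v = c *\<^sub>R a" by (rule parallel_if_perp[OF A(3)])
    moreover have "y \<bullet> (snd v *v a) = 0" if "y \<bullet> (A *v a) = 0" for y
    proof (rule derivative_in_kernel[OF \<gamma>(2)])
      show "bounded_linear (\<lambda>v :: rep. y \<bullet> (snd v *v a))"
        unfolding linear_conv_bounded_linear[symmetric]
        by (rule linearI) (simp_all add: qf_add qf_scaleR flip: qf_def)
      show "\<forall>\<^sub>F t in nhds 0. y \<bullet> (snd (\<gamma> t) *v a) = 0"
        using ev by eventually_elim (use that in auto)
    qed
    then have "\<exists>s. snd v *v a = s *\<^sub>R (A *v a)" by (rule parallel_if_perp[OF A(4)])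
    ultimately show "v \<in> ?R" by blast
  next
    fix v assume "v \<in> ?R"
    then obtain c s V where v: "v = (c *\<^sub>R a, V)" "transpose V = V" "V *v a = s *\<^sub>R (A *v a)"
      by (cases v) auto
    \<comment> \<open>Along the line \<open>a\<close> and \<open>A *v a\<close> are only multiplied
      by products of these factors; the spans stay the same as long as the factors are
      nonzero.\<close>
    have "\<forall>\<^sub>F t in nhds 0. 1 + t * c \<noteq> 0" "\<forall>\<^sub>F t in nhds 0. 1 + t * s \<noteq> 0"
    proof -
      have "((\<lambda>t. 1 + t * x) \<longlongrightarrow> 1 + 0 * x) (nhds 0)" for x :: real
        by (intro tendsto_intros filterlim_ident)
      then show "\<forall>\<^sub>F t in nhds 0. 1 + t * c \<noteq> 0" "\<forall>\<^sub>F t in nhds 0. 1 + t * s \<noteq> 0"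
        by (auto intro!: tendsto_imp_eventually_ne[where c = "1 + 0 * _"])
    qed
    moreover have "\<forall>\<^sub>F t in nhds 0. proj_class ((a, A) + t *\<^sub>R v) \<in> N"
      by (rule eventually_line_in_N[OF N]) (simp add: v)
    ultimately have "\<forall>\<^sub>F t in nhds 0. proj_class ((a, A) + t *\<^sub>R v) \<in> polar_fibre (a, A)"
    proof eventually_elim
      case (elim t)
      have 1: "a + t *\<^sub>R c *\<^sub>R a = (1 + t * c) *\<^sub>R a" by (simp add: algebra_simps)
      have "(A + t *\<^sub>R V) *v ((1 + t * c) *\<^sub>R a) = ((1 + t * c) * (1 + t * s)) *\<^sub>R (A *v a)"
        by (simp add: v(3) matrix_vector_mult_add_rdistrib matrix_vector_mult_scaleR
            scaleR_matrix_vector_assoc[symmetric] algebra_simps)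
      then show ?case
        using elim unfolding v(1) scaleR_Pair add_Pair fibre 1 by (simp add: span_scaleR_singleton)
    qed
    then show "v \<in> tangent_lifts (polar_fibre (a, A)) (a, A)" by (rule tangent_liftsI)
  qed
qed

section \<open>The radical of the dancing form\<close>

definition sym_outer :: "real^3 \<Rightarrow> real^3 \<Rightarrow> real^3^3" where
  "sym_outer x y = (\<chi> i j. x $ i * y $ j + y $ i * x $ j)"

lemma qf_sym_outer: "qf (sym_outer x y) p q = (x \<bullet> p) * (y \<bullet> q) + (y \<bullet> p) * (x \<bullet> q)"
  by (simp add: qf_sum sym_outer_def inner_vec_def sum_3 algebra_simps)

lemma transpose_sym_outer: "transpose (sym_outer x y) = sym_outer x y"
  by (simp add: transpose_eq_iff sym_outer_def mult.commute add.commute)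

lemma radical_dancing_form:
  assumes N: "proj_class (a, A) \<in> N"
  shows "radical_on {v :: rep. transpose (snd v) = snd v} (dancing_form (a, A)) =
    {v :: rep. transpose (snd v) = snd v \<and> (\<exists>c. fst v = c *\<^sub>R a) \<and> (\<exists>s. snd v *v a = s *\<^sub>R (A *v a))}"
    (is "_ = ?R")
proof -
  have A: "transpose A = A" "qf A a a \<noteq> 0" "a \<noteq> 0" "A *v a \<noteq> 0"
    using N by (auto simp: proj_class_in_N_iff irreducible_conic_iff_det qf_def)
  \<comment> \<open>For symmetric matrices the polarization at \<open>(u, V)\<close> and
    \<open>(u', V')\<close> is \<open>\<xi>(V) \<bullet> u' + \<xi>(V') \<bullet> u\<close>.\<close>
  have pol: "dpol a A v w = (qf A a a *\<^sub>R (snd v *v a) - qf (snd v) a a *\<^sub>R (A *v a)) \<bullet> fst w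
       + (qf A a a *\<^sub>R (snd w *v a) - qf (snd w) a a *\<^sub>R (A *v a)) \<bullet> fst v"
    if "transpose (snd v) = snd v" "transpose (snd w) = snd w" for v w
  proof -
    have "(M *v a) \<bullet> x = qf M x a" for M x by (simp add: qf_def inner_commute)
    then show ?thesis
      unfolding dpol_def
      using qf_sym[OF that(1), of a "fst w"] qf_sym[OF that(2), of a "fst v"]
        qf_sym[OF A(1), of a "fst v"] qf_sym[OF A(1), of a "fst w"]
      by (simp add: inner_simps field_simps)
  qed
  show ?thesis
  proof (intro equalityI subsetI)
    fix v assume "v \<in> radical_on {v :: rep. transpose (snd v) = snd v} (dancing_form (a, A))"
    then have sv: "transpose (snd v) = snd v"
      and r: "\<And>w. transpose (snd w) = snd w \<Longrightarrow> dpol a A v w = 0"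
      by (auto simp: radical_on_def polarization_dancing_form)
    \<comment> \<open>This is \<open>\<xi>(V)\<close>. Pairing \<open>v\<close> with
      \<open>(x, 0)\<close> gives its squared length, so it vanishes on the radical.\<close>
    define x where "x = qf A a a *\<^sub>R (snd v *v a) - qf (snd v) a a *\<^sub>R (A *v a)"
    have s0: "transpose (0 :: real^3^3) = 0" by (simp add: transpose_eq_iff)
    have "dpol a A v (x, 0) = x \<bullet> x"
      using sv s0 by (simp add: pol x_def)
    then have "x \<bullet> x = 0" using r[of "(x, 0)"] s0 by simp
    then have "qf A a a *\<^sub>R (snd v *v a) = qf (snd v) a a *\<^sub>R (A *v a)" by (simp add: x_def)
    then have "(1 / qf A a a) *\<^sub>R qf A a a *\<^sub>R (snd v *v a) = (1 / qf A a a) *\<^sub>R qf (snd v) a a *\<^sub>R (A *v a)" by simp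
    then have "snd v *v a = (qf (snd v) a a / qf A a a) *\<^sub>R (A *v a)" using A(2) by simp
    moreover have "y \<bullet> fst v = 0" if "y \<bullet> a = 0" for y
    proof -
      \<comment> \<open>The test matrix \<open>sym_outer a y\<close> isolates the component of
        \<open>fst v\<close> along \<open>y\<close>, for \<open>y\<close> orthogonal to
        \<open>a\<close>.\<close>
      have "dpol a A v (0, sym_outer a y) = 0" by (rule r) (simp add: transpose_sym_outer)
      moreover have "dpol a A v (0, sym_outer a y) = qf A a a * (a \<bullet> a) * (y \<bullet> fst v)"
        using that by (simp add: dpol_def qf_sym_outer algebra_simps)
      ultimately show ?thesis using A by simp
    qed
    then have "\<exists>c. fst v = c *\<^sub>R a" by (rule parallel_if_perp[OF A(3)])
    ultimately show "v \<in> ?R" using sv by blast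
  next
    fix v assume "v \<in> ?R"
    then obtain c s where v: "transpose (snd v) = snd v" "fst v = c *\<^sub>R a" "snd v *v a = s *\<^sub>R (A *v a)" by blast
    \<comment> \<open>Now \<open>\<xi>(V) = 0\<close>, and the other term vanishes because
      \<open>\<xi>(V')\<close> is orthogonal to \<open>a\<close>.\<close>
    have "qf (snd v) a a = s * qf A a a" unfolding qf_def v(3) by simp
    then have "dpol a A v w = 0" if "transpose (snd w) = snd w" for w
      unfolding pol[OF v(1) that] v(2,3)
      by (simp add: inner_simps) (simp add: qf_def inner_commute)
    with v show "v \<in> radical_on {v :: rep. transpose (snd v) = snd v} (dancing_form (a, A))"
      by (simp add: radical_on_def polarization_dancing_form)
  qed
qed

subsection \<open>The signature\<close>

text \<open>The functionals are the coordinates with respect to the vectors \<open>v i\<close>: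
  duality yields injectivity, independence and the trivial intersection with \<open>K\<close>, and
  the expansion of \<open>w\<close> yields spanning.\<close>

lemma quotient_signature_if_dual_basis:
  fixes v :: "'i \<Rightarrow> 'v::real_vector" and \<phi> :: "'i \<Rightarrow> 'v \<Rightarrow> real"
  assumes fin: "finite IP" "finite IM" "finite IZ" "finite IK"
    and disj: "IP \<inter> IM = {}" "IP \<inter> IZ = {}" "IM \<inter> IZ = {}" "(IP \<union> IM \<union> IZ) \<inter> IK = {}"
    and I: "I = IP \<union> IM \<union> IZ \<union> IK"
    and lin: "\<And>i. i \<in> I \<Longrightarrow> linear (\<phi> i)"
    and dual: "\<And>i j. i \<in> I \<Longrightarrow> j \<in> I \<Longrightarrow> \<phi> i (v j) = (if i = j then 1 else 0)"
    and W: "subspace W" "v ` I \<subseteq> W" "\<And>w. w \<in> W \<Longrightarrow> w = (\<Sum>i\<in>I. \<phi> i w *\<^sub>R v i)"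
    and K: "K = span (v ` IK)" "K \<subseteq> radical_on W Q"
    and Q: "quadratic_form Q"
    and orth: "\<And>i j. i \<in> IP \<union> IM \<union> IZ \<Longrightarrow> j \<in> IP \<union> IM \<union> IZ \<Longrightarrow> i \<noteq> j \<Longrightarrow> polarization Q (v i) (v j) = 0"
    and vals: "\<And>i. i \<in> IP \<Longrightarrow> Q (v i) = 1" "\<And>i. i \<in> IM \<Longrightarrow> Q (v i) = - 1" "\<And>i. i \<in> IZ \<Longrightarrow> Q (v i) = 0"
  shows "quotient_signature W K Q (card IP) (card IM) (card IZ)"
proof -
  let ?J = "IP \<union> IM \<union> IZ"
  have inj: "inj_on v I"
    by (rule inj_onI) (metis dual zero_neq_one)
  \<comment> \<open>A coordinate functional vanishes on the span of basis vectors with other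
    indices.\<close>
  have ker: "\<phi> i x = 0" if "i \<in> I" "S \<subseteq> I" "i \<notin> S" "x \<in> span (v ` S)" for i S x
    by (rule linear_eq_0_on_span[OF lin[OF that(1)] _ that(4)]) (use that dual in auto)
  have img: "v ` IP \<union> v ` IM \<union> v ` IZ = v ` ?J" by auto
  have indep: "independent (v ` ?J)"
  proof -
    have False if i: "i \<in> ?J" and s: "v i \<in> span (v ` ?J - {v i})" for i
    proof -
      have "v i \<in> span (v ` (?J - {i}))"
        by (rule subsetD[OF span_mono s]) auto
      with i I ker[of i "?J - {i}" "v i"] dual[of i i] show False by auto
    qed
    then show ?thesis unfolding dependent_def by blast
  qed
  have KW: "K \<subseteq> W" using K(2) by (auto simp: radical_on_def)
  have meet: "span (v ` ?J) \<inter> K = {0}"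
  proof (intro equalityI subsetI)
    fix x assume x: "x \<in> span (v ` ?J) \<inter> K"
    \<comment> \<open>Coordinates with index in \<open>IK\<close> vanish because \<open>x\<close>
      lies in the span of the others; the remaining ones vanish because \<open>x\<close> lies in
      \<open>K\<close>.\<close>
    have "\<phi> i x = 0" if "i \<in> I" for i
    proof (cases "i \<in> IK")
      case True
      then show ?thesis using ker[of i ?J x] x that disj I by auto
    next
      case False
      then show ?thesis using ker[of i IK x] x that K I by auto
    qed
    then show "x \<in> {0}" using W(3)[of x] x KW by auto
  qed (use K(1) span_zero in auto)
  have spanW: "span (v ` ?J \<union> K) = W"
  proof (intro equalityI subsetI)
    fix w assume "w \<in> W"
    have "v i \<in> span (v ` ?J \<union> K)" if "i \<in> I" for i
      using that unfolding I K(1) by (auto intro!: span_base intro: span_base[of _ "v ` IK"])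
    then have "(\<Sum>i\<in>I. \<phi> i w *\<^sub>R v i) \<in> span (v ` ?J \<union> K)"
      by (intro span_sum span_mul)
    then show "w \<in> span (v ` ?J \<union> K)" using W(3)[OF \<open>w \<in> W\<close>] by simp
  qed (use span_minimal[of "v ` ?J \<union> K" W] W KW I in blast)
  have card: "card (v ` S) = card S" if "S \<subseteq> I" for S
    using inj that by (meson card_image inj_on_subset)
  have disjoint: "v ` S \<inter> v ` T = {}" if "S \<subseteq> I" "T \<subseteq> I" "S \<inter> T = {}" for S T
    using inj that by (metis image_empty inj_on_image_Int)
  have sub: "IP \<subseteq> I" "IM \<subseteq> I" "IZ \<subseteq> I" using I by auto
  have orth': "\<forall>x\<in>v ` ?J. \<forall>y\<in>v ` ?J. x \<noteq> y \<longrightarrow> polarization Q x y = 0"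
    using orth by blast
  have vals': "\<forall>x\<in>v ` IP. Q x = 1" "\<forall>x\<in>v ` IM. Q x = - 1" "\<forall>x\<in>v ` IZ. Q x = 0"
    using vals by blast+
  have sK: "subspace K" using K(1) by simp
  show ?thesis
    unfolding quotient_signature_def
    by (rule conjI[OF W(1) conjI[OF sK conjI[OF K(2) conjI[OF Q]]]],
        rule exI[of _ "v ` IP"], rule exI[of _ "v ` IM"], rule exI[of _ "v ` IZ"], unfold img, intro conjI)
      (rule orth' vals' indep meet spanW | simp only: card disjoint sub disj fin finite_imageI)+
qed

text \<open>An orthonormal basis of the orthogonal complement of \<open>a\<close> is adjoined to
  \<open>a\<close>, which itself stays unnormalized.\<close>

lemma orthogonal_frame:
  fixes a :: "real^3"
  assumes "a \<noteq> 0"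
  obtains e f where "a \<bullet> e = 0" "a \<bullet> f = 0" "e \<bullet> f = 0" "e \<bullet> e = 1" "f \<bullet> f = 1"
    "\<And>x. x = (x \<bullet> a / (a \<bullet> a)) *\<^sub>R a + (x \<bullet> e) *\<^sub>R e + (x \<bullet> f) *\<^sub>R f"
proof -
  let ?H = "{x. a \<bullet> x = 0}"
  obtain B where B: "B \<subseteq> ?H" "pairwise orthogonal B" "\<And>x. x \<in> B \<Longrightarrow> norm x = 1"
      "card B = dim ?H" "span B = ?H"
    using orthonormal_basis_subspace[OF subspace_hyperplane[of a]] by metis
  have "card B = 2" using B(4) dim_hyperplane[OF assms] by simp
  then obtain e f where ef: "B = {e, f}" "e \<noteq> f" by (meson card_2_iff)
  have o: "a \<bullet> e = 0" "a \<bullet> f = 0" "e \<bullet> f = 0" "e \<bullet> e = 1" "f \<bullet> f = 1"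
    using B(1-3) ef by (auto simp: pairwise_def orthogonal_def norm_eq_1)
  have "x = (x \<bullet> a / (a \<bullet> a)) *\<^sub>R a + (x \<bullet> e) *\<^sub>R e + (x \<bullet> f) *\<^sub>R f" for x
  proof -
    have "x - (x \<bullet> a / (a \<bullet> a)) *\<^sub>R a \<in> ?H"
      using assms by (simp add: inner_simps inner_commute)
    then obtain s t where st: "x - (x \<bullet> a / (a \<bullet> a)) *\<^sub>R a = s *\<^sub>R e + t *\<^sub>R f"
      unfolding B(5)[symmetric] ef(1) by (auto simp: span_insert span_singleton algebra_simps)
    have "x \<bullet> e = (x - (x \<bullet> a / (a \<bullet> a)) *\<^sub>R a) \<bullet> e" "x \<bullet> f = (x - (x \<bullet> a / (a \<bullet> a)) *\<^sub>R a) \<bullet> f"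
      using o by (simp_all add: inner_simps)
    then have "x \<bullet> e = s" "x \<bullet> f = t"
      unfolding st using o by (simp_all add: inner_simps inner_commute[of f e])
    with st show ?thesis by (simp add: algebra_simps)
  qed
  with that o show ?thesis by blast
qed

lemma signature_dancing_form:
  assumes N: "proj_class (a, A) \<in> N"
  shows "quotient_signature {v :: rep. transpose (snd v) = snd v} (rescalings (a, A)) (dancing_form (a, A)) 2 2 3"
proof -
  define \<alpha> where "\<alpha> = qf A a a"
  define n where "n = a \<bullet> a"
  have A: "transpose A = A" "qf A a a = \<alpha>" "\<alpha> \<noteq> 0" "a \<noteq> 0" 
    using N by (auto simp: proj_class_in_N_iff irreducible_conic_iff_det \<alpha>_def)
  have n: "a \<bullet> a = n" "n \<noteq> 0" using A(4) by (simp_all add: n_def)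
  obtain e f where ef: "a \<bullet> e = 0" "a \<bullet> f = 0" "e \<bullet> f = 0" "e \<bullet> e = 1" "f \<bullet> f = 1"
    and dec: "\<And>x. x = (x \<bullet> a / n) *\<^sub>R a + (x \<bullet> e) *\<^sub>R e + (x \<bullet> f) *\<^sub>R f"
    using orthogonal_frame[OF A(4)] unfolding n by metis
  have ef': "e \<bullet> a = 0" "f \<bullet> a = 0" "f \<bullet> e = 0" using ef by (simp_all add: inner_commute)
  \<comment> \<open>The factor makes \<open>qf E e a = 1 / (2 * \<alpha>)\<close>, so that
    \<open>(e, E)\<close> has square 1 and \<open>(e, - E)\<close> square -1; likewise for
    \<open>F\<close>.\<close>
  define E where "E = (1 / (2 * \<alpha> * n)) *\<^sub>R sym_outer e a"
  define F where "F = (1 / (2 * \<alpha> * n)) *\<^sub>R sym_outer f a"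
  define Ze where "Ze = (1 / 2) *\<^sub>R sym_outer e e"
  define Zf where "Zf = (1 / 2) *\<^sub>R sym_outer f f"
  define Zm where "Zm = sym_outer e f"
  have sEF: "transpose E = E" "transpose F = F" "transpose Ze = Ze" "transpose Zf = Zf" "transpose Zm = Zm"
    using transpose_sym_outer unfolding transpose_eq_iff E_def F_def Ze_def Zf_def Zm_def by simp_all
  have qE: "qf E x y = ((e \<bullet> x) * (a \<bullet> y) + (a \<bullet> x) * (e \<bullet> y)) / (2 * \<alpha> * n)"
    and qF: "qf F x y = ((f \<bullet> x) * (a \<bullet> y) + (a \<bullet> x) * (f \<bullet> y)) / (2 * \<alpha> * n)"
    and qZ: "qf Ze x y = (e \<bullet> x) * (e \<bullet> y)" "qf Zf x y = (f \<bullet> x) * (f \<bullet> y)"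
      "qf Zm x y = (e \<bullet> x) * (f \<bullet> y) + (f \<bullet> x) * (e \<bullet> y)" for x y
    by (simp_all add: E_def F_def Ze_def Zf_def Zm_def qf_scaleR qf_sym_outer)
  \<comment> \<open>\<open>e\<close> pairs with \<open>2 E\<close> to a hyperbolic plane, since \<open>\<xi>(E) = e / 2\<close>; \<open>Ze\<close>, \<open>Zf\<close>, \<open>Zm\<close> span the symmetric matrices killing \<open>a\<close>\<close>
  define w :: "nat \<Rightarrow> rep" where
    "w i = [(e, E), (f, F), (e, - E), (f, - F), (0, Ze), (0, Zf), (0, Zm), (a, 0), (0, A)] ! i" for i
  \<comment> \<open>Subtracts the multiple of \<open>A\<close> that agrees with the matrix at
    \<open>(a, a)\<close>, which removes the direction of rescaling \<open>A\<close>.\<close>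
  define r :: "rep \<Rightarrow> real^3 \<Rightarrow> real^3 \<Rightarrow> real" where
    "r v x y = qf (snd v) x y - qf (snd v) a a / \<alpha> * qf A x y" for v x y
  \<comment> \<open>The functionals dual to \<open>w\<close>. The components along
    \<open>(e, E)\<close> and \<open>(e, - E)\<close> are recovered as half the sum and half the
    difference of \<open>fst v \<bullet> e\<close> and \<open>2 * \<alpha> * r v e a\<close>;
    similarly for \<open>f\<close>.\<close>
  define \<phi> :: "nat \<Rightarrow> rep \<Rightarrow> real" where
    "\<phi> i = [\<lambda>v. (fst v \<bullet> e) / 2 + \<alpha> * r v e a, \<lambda>v. (fst v \<bullet> f) / 2 + \<alpha> * r v f a,
       \<lambda>v. (fst v \<bullet> e) / 2 - \<alpha> * r v e a, \<lambda>v. (fst v \<bullet> f) / 2 - \<alpha> * r v f a,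
       \<lambda>v. r v e e, \<lambda>v. r v f f, \<lambda>v. r v e f, \<lambda>v. (fst v \<bullet> a) / n, \<lambda>v. qf (snd v) a a / \<alpha>] ! i" for i
  have r_lin: "r (v + v') x y = r v x y + r v' x y" "r (c *\<^sub>R v) x y = c * r v x y" for v v' c x y
    by (simp_all add: r_def qf_add qf_scaleR add_divide_distrib algebra_simps)
  have qf_minus: "qf (- X) x y = - qf X x y" for X x y
    using qf_scaleR(3)[of "-1" X x y] by simp
  have ww: "w 0 = (e, E)" "w 1 = (f, F)" "w 2 = (e, - E)" "w 3 = (f, - F)" "w 4 = (0, Ze)" "w 5 = (0, Zf)"
      "w 6 = (0, Zm)" "w 7 = (a, 0)" "w 8 = (0, A)"
    by (simp_all add: w_def)
  have pp: "\<phi> 0 = (\<lambda>v. (fst v \<bullet> e) / 2 + \<alpha> * r v e a)" "\<phi> 1 = (\<lambda>v. (fst v \<bullet> f) / 2 + \<alpha> * r v f a)"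
    "\<phi> 2 = (\<lambda>v. (fst v \<bullet> e) / 2 - \<alpha> * r v e a)" "\<phi> 3 = (\<lambda>v. (fst v \<bullet> f) / 2 - \<alpha> * r v f a)"
    "\<phi> 4 = (\<lambda>v. r v e e)" "\<phi> 5 = (\<lambda>v. r v f f)" "\<phi> 6 = (\<lambda>v. r v e f)" "\<phi> 7 = (\<lambda>v. (fst v \<bullet> a) / n)"
    "\<phi> 8 = (\<lambda>v. qf (snd v) a a / \<alpha>)"
    by (simp_all add: \<phi>_def)
  have tab: "qf E a a = 0" "qf E e a = 1 / (2 * \<alpha>)" "qf E f a = 0" "qf E e e = 0" "qf E f f = 0" "qf E e f = 0"
    "qf F a a = 0" "qf F e a = 0" "qf F f a = 1 / (2 * \<alpha>)" "qf F e e = 0" "qf F f f = 0" "qf F e f = 0"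
    "qf Ze a a = 0" "qf Ze e a = 0" "qf Ze f a = 0" "qf Ze e e = 1" "qf Ze f f = 0" "qf Ze e f = 0"
    "qf Zf a a = 0" "qf Zf e a = 0" "qf Zf f a = 0" "qf Zf e e = 0" "qf Zf f f = 1" "qf Zf e f = 0"
    "qf Zm a a = 0" "qf Zm e a = 0" "qf Zm f a = 0" "qf Zm e e = 0" "qf Zm f f = 0" "qf Zm e f = 1"
    "qf A a a = \<alpha>"
    using n A(2) by (simp_all add: qE qF qZ ef ef')
  let ?IP = "{0, 1} :: nat set" and ?IM = "{2, 3} :: nat set" and ?IZ = "{4, 5, 6} :: nat set" and ?IK = "{7, 8} :: nat set"
  let ?I = "?IP \<union> ?IM \<union> ?IZ \<union> ?IK"
  let ?W = "{v :: rep. transpose (snd v) = snd v}"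
  let ?Q = "dancing_form (a, A)"
  have sA: "qf A e a = qf A a e" "qf A f a = qf A a f" "qf A f e = qf A e f"
    using qf_sym[OF A(1)] by blast+
  have K: "rescalings (a, A) = span (w ` ?IK)"
    by (simp add: rescalings_def ww)
  have "quotient_signature ?W (rescalings (a, A)) ?Q (card ?IP) (card ?IM) (card ?IZ)"
  proof (rule quotient_signature_if_dual_basis[where I = ?I and v = w and \<phi> = \<phi> and IK = ?IK])
    show "linear (\<phi> i)" if "i \<in> ?I" for i
      using that
      by (elim UnE insertE emptyE; simp only: pp linear_iff)
        (simp_all add: inner_simps r_lin qf_add qf_scaleR add_divide_distrib algebra_simps del: split_paired_All)
    show "\<phi> i (w j) = (if i = j then 1 else 0)" if "i \<in> ?I" "j \<in> ?I" for i j
      using that A(3) n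
      by (elim UnE insertE emptyE; simp only: pp ww)
        (simp_all add: r_def tab qf_minus ef ef')
    show "subspace ?W"
      unfolding subspace_def by (auto simp: transpose_eq_iff)
    show "w ` ?I \<subseteq> ?W"
      using sEF A(1) by (auto simp: ww transpose_eq_iff simp del: One_nat_def)
    show "v = (\<Sum>i\<in>?I. \<phi> i v *\<^sub>R w i)" if "v \<in> ?W" for v
    proof -
      obtain u V where v: "v = (u, V)" by (cases v)
      have V: "transpose V = V" using that v by simp
      have r: "r v x y = qf V x y - qf V a a / \<alpha> * qf A x y" for x y by (simp add: r_def v)
      \<comment> \<open>\<open>V\<close> minus its proposed expansion; the coefficient of
        \<open>E\<close> is \<open>\<phi> 0 v - \<phi> 2 v\<close>, that of \<open>F\<close> is
        \<open>\<phi> 1 v - \<phi> 3 v\<close>. A symmetric form vanishing on all pairs from the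
        frame \<open>a\<close>, \<open>e\<close>, \<open>f\<close> is zero.\<close>
      define D where "D = V - ((2 * \<alpha> * r v e a) *\<^sub>R E + (2 * \<alpha> * r v f a) *\<^sub>R F
        + r v e e *\<^sub>R Ze + r v f f *\<^sub>R Zf + r v e f *\<^sub>R Zm + (qf V a a / \<alpha>) *\<^sub>R A)"
      have qD: "qf D x y = qf V x y - (2 * \<alpha> * r v e a * qf E x y + 2 * \<alpha> * r v f a * qf F x y
        + r v e e * qf Ze x y + r v f f * qf Zf x y + r v e f * qf Zm x y + qf V a a / \<alpha> * qf A x y)" for x y
        by (simp add: D_def qf_add qf_diff qf_scaleR)
      have sD: "transpose D = D"
        using V A(1) sEF by (simp add: D_def transpose_eq_iff)
      have V_r: "qf V x y = r v x y + qf V a a / \<alpha> * qf A x y" for x y by (simp add: r)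
      have D0: "qf D a a = 0" "qf D e a = 0" "qf D f a = 0" "qf D e e = 0" "qf D f f = 0" "qf D e f = 0"
        using A(3) V_r[of e a] V_r[of f a] V_r[of e e] V_r[of f f] V_r[of e f] unfolding qD tab by simp_all
      have D0': "qf D a e = 0" "qf D a f = 0" "qf D f e = 0" using D0 qf_sym[OF sD] by metis+
      have "qf D x x = 0" for x
        by (subst (1 2) dec[of x]) (simp add: qf_add qf_scaleR D0 D0')
      then have "D = 0" by (rule sym_eq_0_if_qf_0[OF sD])
      have S: "(\<Sum>i\<in>?I. \<phi> i v *\<^sub>R w i) = \<phi> 0 v *\<^sub>R w 0 + \<phi> 1 v *\<^sub>R w 1 + \<phi> 2 v *\<^sub>R w 2 + \<phi> 3 v *\<^sub>R w 3
        + \<phi> 4 v *\<^sub>R w 4 + \<phi> 5 v *\<^sub>R w 5 + \<phi> 6 v *\<^sub>R w 6 + \<phi> 7 v *\<^sub>R w 7 + \<phi> 8 v *\<^sub>R w 8"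
        by (simp add: add.assoc)
      have "fst (\<Sum>i\<in>?I. \<phi> i v *\<^sub>R w i) = (u \<bullet> a / n) *\<^sub>R a + (u \<bullet> e) *\<^sub>R e + (u \<bullet> f) *\<^sub>R f"
        unfolding S pp ww by (simp add: v vec_eq_iff algebra_simps)
      also have "\<dots> = u" by (rule dec[symmetric])
      finally have 1: "fst (\<Sum>i\<in>?I. \<phi> i v *\<^sub>R w i) = u" .
      have "snd (\<Sum>i\<in>?I. \<phi> i v *\<^sub>R w i) = V - D"
        unfolding S pp ww D_def by (simp add: v vec_eq_iff algebra_simps)
      then have 2: "snd (\<Sum>i\<in>?I. \<phi> i v *\<^sub>R w i) = V" using \<open>D = 0\<close> by simp
      show ?thesis unfolding v using 1 2 by (simp add: prod_eq_iff v)
    qed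
    show "rescalings (a, A) = span (w ` ?IK)" by (rule K)
    show "rescalings (a, A) \<subseteq> radical_on ?W ?Q"
    proof
      fix v assume "v \<in> rescalings (a, A)"
      then obtain s t where "v - s *\<^sub>R (a, 0) = t *\<^sub>R (0, A)"
        by (auto simp: rescalings_def span_insert span_singleton simp del: scaleR_Pair)
      then have v: "v = (s *\<^sub>R a, t *\<^sub>R A)" by (simp add: diff_eq_eq)
      show "v \<in> radical_on ?W ?Q"
        using A(1) unfolding radical_dancing_form[OF N]
        by (auto simp: v transpose_eq_iff scaleR_matrix_vector_assoc[symmetric])
    qed
    show "quadratic_form ?Q" by (rule quadratic_form_dancing_form)
    show "polarization ?Q (w i) (w j) = 0" if "i \<in> ?IP \<union> ?IM \<union> ?IZ" "j \<in> ?IP \<union> ?IM \<union> ?IZ" "i \<noteq> j" for i j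
      using that
      by (elim UnE insertE emptyE; simp only: ww polarization_dancing_form)
        (simp_all add: dpol_def qE qF qZ qf_minus ef ef' A n)
    show "?Q (w i) = 1" if "i \<in> ?IP" for i
      using that A(3) n(2) by (elim insertE emptyE; simp only: ww dancing_form_eq)
        (simp_all add: dform_def qE qF qZ qf_minus ef ef' A n)
    show "?Q (w i) = - 1" if "i \<in> ?IM" for i
      using that A(3) n(2) by (elim insertE emptyE; simp only: ww dancing_form_eq)
        (simp_all add: dform_def qE qF qZ qf_minus ef ef' A n)
    show "?Q (w i) = 0" if "i \<in> ?IZ" for i
      using that by (elim insertE emptyE; simp only: ww dancing_form_eq)
        (simp_all add: dform_def qE qF qZ qf_minus ef ef' A n)
  qed simp_all
  then show ?thesis by (simp add: eval_nat_numeral)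
qed

theorem theorem2p5:
  shows
   "(\<forall>a A b B. proj_class (a, A) \<in> N \<and> proj_class (b, B) \<in> N \<longrightarrow>
        (dancing (a, A) (b, B) \<longrightarrow>
           (a \<bullet> (A *v a)) * (b \<bullet> (B *v b)) - (a \<bullet> (B *v a)) * (b \<bullet> (A *v b)) = 0) \<and>
        (span {A} \<noteq> span {B} \<longrightarrow>
           ((\<exists>C. conic_through C (a, A) (b, B)) \<longleftrightarrow>
              (a \<bullet> (A *v a)) * (b \<bullet> (B *v b)) - (a \<bullet> (B *v a)) * (b \<bullet> (A *v b)) = 0)) \<and>
        (span {A} \<noteq> span {B} \<and>
         (\<forall>C. conic_through C (a, A) (b, B) \<longrightarrow> irreducible_conic C) \<longrightarrow>
           (dancing (a, A) (b, B) \<longleftrightarrow>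
              (a \<bullet> (A *v a)) * (b \<bullet> (B *v b)) - (a \<bullet> (B *v a)) * (b \<bullet> (A *v b)) = 0))) \<and>
    polar_projection ` N = proj_points \<times> proj_lines - incident_pairs \<and>
    real_polynomial_function (\<lambda>(p, v). dancing_form p v) \<and>
    (\<forall>a A. proj_class (a, A) \<in> N \<longrightarrow>
        (\<forall>v\<in>tangent_lifts N (a, A).
           dancing_expr (a, A) (a, A) = 0 \<and>
           deriv (\<lambda>\<epsilon>. dancing_expr (a, A) ((a, A) + \<epsilon> *\<^sub>R v)) 0 = 0) \<and>
        (\<forall>c d. c \<noteq> 0 \<and> d \<noteq> 0 \<longrightarrow>
           (\<exists>k>0. \<forall>v\<in>tangent_lifts N (a, A).
              dancing_form (c *\<^sub>R a, d *\<^sub>R A) (c *\<^sub>R fst v, d *\<^sub>R snd v) =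
                k * dancing_form (a, A) v)) \<and>
        quotient_signature (tangent_lifts N (a, A)) (rescalings (a, A))
          (dancing_form (a, A)) 2 2 3 \<and>
        radical_on (tangent_lifts N (a, A)) (dancing_form (a, A)) =
          tangent_lifts (polar_fibre (a, A)) (a, A))"
proof (intro conjI allI impI, goal_cases)
  \<comment> \<open>Coinciding conics make the expression vanish by proportionality; for distinct
    ones the determinant criterion applies.\<close>
  case (1 a A b B)
  then show ?case
    using conic_through_iff_qexpr[of A B a b] qexpr_0_if_span_eq[of A B a b]
    unfolding proj_class_in_N_iff dancing_def qexpr_def qf_def by blast
next
  case (2 a A b B)
  then show ?case
    using conic_through_iff_qexpr[of A B a b]
    unfolding proj_class_in_N_iff qexpr_def qf_def by blast
next
  \<comment> \<open>By assumption any conic through the configuration is irreducible, so its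
    existence already amounts to dancing.\<close>
  case (3 a A b B)
  then show ?case
    using conic_through_iff_qexpr[of A B a b]
    unfolding proj_class_in_N_iff dancing_def qexpr_def qf_def by blast
next
  case 4
  show ?case by (rule image_polar_projection)
next
  case 5
  show ?case by (rule real_polynomial_function_dancing_form)
next
  case (6 a A)
  show ?case by (simp add: deriv_dancing_expr del: scaleR_Pair)
next
  case (7 a A c d)
  then show ?case
    by (intro exI[of _ "c ^ 4 * d ^ 2"]) (simp add: dancing_form_scale zero_less_mult_iff zero_less_power_eq)
next
  case (8 a A)
  then show ?case
    unfolding tangent_lifts_N[OF 8] by (rule signature_dancing_form)
next
  case (9 a A)
  then show ?case
    unfolding tangent_lifts_N[OF 9] tangent_lifts_polar_fibre[OF 9] by (rule radical_dancing_form)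
qed

end
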